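(* For every positive integer $n$ we have \[ q(n)= \left\{ \begin{array}{ll} n,&\text{if } 1\leqslant n\leqslant 5;\\[1mm] \left\lfloor\frac{4n}{3}\right\rfloor,&\text{if } n\geqslant 6. \end{array}\right. \]
   Context: The $n\times n$ board is the set of cells $(r,c)$ with $1\leqslant r,c\leqslant n$ (row $r$, column $c$). A configuration is a set of cells, thought of as the cells occupied by queens. Two distinct cells lie on a common line if they have the same row $r$, the same column $c$, the same difference $r-c$, or the same sum $r+c$. Two distinct queens of a configuration attack each other if they lie on a common line and no other queen of the configuration stands between them on that line. A configuration is admissible if no queen attacks more than one other queen. $q(n)$ denotes the largest number of queens in an admissible configuration on the $n\times n$ board. *)

theory Defs
  imports Complex_Main
begin

text \<open>Cells are pairs (row, column) of integers, so that the difference of the two coordinates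
  is not truncated.\<close>

type_synonym cell = "int \<times> int"

definition board :: "nat \<Rightarrow> cell set" where
  "board n = {1..int n} \<times> {1..int n}"

text \<open>Each function below is constant exactly on the lines of one of the four directions.\<close>

definition line_directions :: "(cell \<Rightarrow> int) set" where
  "line_directions = {\<lambda>(r, c). r, \<lambda>(r, c). c, \<lambda>(r, c). r - c, \<lambda>(r, c). r + c}"

definition on_common_line :: "cell \<Rightarrow> cell \<Rightarrow> bool" where
  "on_common_line p q \<longleftrightarrow> p \<noteq> q \<and> (\<exists>f\<in>line_directions. f p = f q)"

text \<open>For three cells on one line, \<open>s\<close> is strictly between \<open>p\<close> and \<open>q\<close> iff it differs from both
  and lies in the rectangle spanned by them.\<close>

definition stands_between :: "cell \<Rightarrow> cell \<Rightarrow> cell \<Rightarrow> bool" where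
  "stands_between s p q \<longleftrightarrow>
     s \<noteq> p \<and> s \<noteq> q \<and>
     (\<exists>f\<in>line_directions. f p = f q \<and> f s = f p) \<and>
     min (fst p) (fst q) \<le> fst s \<and> fst s \<le> max (fst p) (fst q) \<and>
     min (snd p) (snd q) \<le> snd s \<and> snd s \<le> max (snd p) (snd q)"

definition attack :: "cell set \<Rightarrow> cell \<Rightarrow> cell \<Rightarrow> bool" where
  "attack Q p q \<longleftrightarrow>
     p \<in> Q \<and> q \<in> Q \<and> on_common_line p q \<and> \<not> (\<exists>s\<in>Q. stands_between s p q)"

definition admissible :: "nat \<Rightarrow> cell set \<Rightarrow> bool" where
  "admissible n Q \<longleftrightarrow> Q \<subseteq> board n \<and> (\<forall>p\<in>Q. card {q. attack Q p q} \<le> 1)"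

definition max_queens :: "nat \<Rightarrow> nat" where
  "max_queens n = Max {card Q | Q. admissible n Q}"

end

theory Submission
  imports Defs
begin

text \<open>
  A configuration is admissible exactly when no queen shares lines with two different queens
  (\<open>admissible_iff\<close>): the middle one of three queens on a line attacks both neighbours, so no line
  carries three queens, and then sharing a line is the same as attacking.

  \<^bold>\<open>Upper bound.\<close> In particular a queen cannot have company both in its row and in its column, and
  a row or a column holds at most two queens. Give every queen the weight
  \<open>1/(queens in its row) + 1/(queens in its column)\<close>, which is therefore at least \<open>3/2\<close>. The weights add
  up to the number of occupied rows plus the number of occupied columns, hence to at most \<open>2 n\<close>, so there
  are at most \<open>4 n / 3\<close> queens. For \<open>n = 3, 4, 5\<close> this bound is \<open>n + 1\<close> after rounding, and an
  exhaustive search excludes \<open>n + 1\<close> queens.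

  \<^bold>\<open>Lower bound.\<close> It suffices to fill a board of size \<open>3 k\<close> with \<open>4 k\<close> queens so that the main diagonal
  is empty: one or two further corner queens on that diagonal then serve the sizes \<open>3 k + 1\<close> and
  \<open>3 k + 2\<close> (\<open>admissible_with_corners\<close>). All filled boards below have pairwise different diagonals and
  pairwise different antidiagonals, so that only rows and columns are shared. They are built as follows.

  \<^item> \<^emph>\<open>Rosettes.\<close> Partition \<open>0, \<dots>, 3 m - 1\<close> into triples \<open>x, y, y'\<close> and let these numbers count
    the rows and columns of a board of size \<open>6 m\<close> from its centre outwards. Each of the \<open>2 m\<close> pairs \<open>(x, y)\<close> yields four queens, the orbit of
    one cell under quarter turns. Rows and columns are then as required, and the numbers of the diagonals and
    antidiagonals are \<open>\<plusminus>(x - y)\<close> and \<open>\<plusminus>(x + y + 1)\<close>. So it suffices that the \<open>4 m\<close> numbers \<open>\<bar>x - y\<bar>\<close>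
    and \<open>x + y + 1\<close> are different. If all of them are at least \<open>g\<close>, the board has a central gap:
    the diagonals and antidiagonals at distance less than \<open>g\<close> from the centre are empty (\<open>gapped\<close>).

  \<^item> \<^emph>\<open>Blowing up.\<close> Replace every queen by a \<open>p \<times> p\<close> block with queens at \<open>(a, 2 a mod p)\<close>. If \<open>p\<close> is
    coprime to 6, then \<open>a\<close>, \<open>2 a\<close>, \<open>a - 2 a\<close> and \<open>a + 2 a\<close> all determine \<open>a\<close> modulo \<open>p\<close>, and the result is
    again a filled board, with a gap of about \<open>p\<close> times the old one (\<open>gapped_blow_up\<close>).

  \<^item> \<^emph>\<open>Frames.\<close> A ring of new rows and columns around a board with a gap can be filled by the rosette of a
    second, small set of triples: in its four corners only the values \<open>\<bar>x - y\<bar>\<close> meet lines of the old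
    board, and they fit into the gap (\<open>gapped_frame\<close>). In the same way nine new rows and columns,
    split into four and five, turn size \<open>6 m\<close> into size \<open>6 m + 9\<close> (\<open>fillable_ring9\<close>).

  The sizes \<open>24 p\<close> and \<open>48 p\<close> with \<open>p\<close> coprime to 6 form a periodic set, and frames bridge the
  distances between its members once \<open>p\<close> is large. So finitely many explicit sets of triples produce a filled board
  of size \<open>6 m\<close> with gap 4 for all \<open>m \<ge> 8\<close> (\<open>gapped_four\<close>). The nine additional rows and
  columns then provide the odd multiples of 3, and the few remaining sizes have explicit boards.
\<close>

section \<open>Admissible means that no queen shares lines with two others\<close>

abbreviation diagonal :: "cell \<Rightarrow> int" where "diagonal p \<equiv> fst p - snd p"
abbreviation antidiagonal :: "cell \<Rightarrow> int" where "antidiagonal p \<equiv> fst p + snd p"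

lemma on_common_line_iff:
  "on_common_line p q \<longleftrightarrow> p \<noteq> q \<and> (fst p = fst q \<or> snd p = snd q \<or> diagonal p = diagonal q \<or> antidiagonal p = antidiagonal q)"
  by (simp add: on_common_line_def line_directions_def split_def)

lemma on_common_line_sym: "on_common_line p q \<longleftrightarrow> on_common_line q p"
  by (auto simp: on_common_line_iff)

lemma stands_between_iff:
  "stands_between s p q \<longleftrightarrow> s \<noteq> p \<and> s \<noteq> q \<and>
     (fst p = fst q \<and> fst s = fst p \<or> snd p = snd q \<and> snd s = snd p \<or>
      diagonal p = diagonal q \<and> diagonal s = diagonal p \<or> antidiagonal p = antidiagonal q \<and> antidiagonal s = antidiagonal p) \<and>
     min (fst p) (fst q) \<le> fst s \<and> fst s \<le> max (fst p) (fst q) \<and>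
     min (snd p) (snd q) \<le> snd s \<and> snd s \<le> max (snd p) (snd q)"
  by (simp add: stands_between_def line_directions_def split_def)

text \<open>
  A form of admissibility that visibly passes to subsets, although the removal of a queen opens a line
  and can create new attacks.
\<close>
definition paired_at_most :: "cell set \<Rightarrow> bool" where
  "paired_at_most Q \<longleftrightarrow>
     (\<forall>p\<in>Q. \<forall>q\<in>Q. \<forall>s\<in>Q. on_common_line p q \<longrightarrow> on_common_line p s \<longrightarrow> q = s)"

lemma stands_between_lines:
  assumes "stands_between s p q"
  shows "on_common_line p s" "on_common_line s q"
  using assms by (auto simp: on_common_line_iff stands_between_iff)

lemma stands_between_trans:
  assumes "stands_between s p q" "stands_between t p s"
  shows "stands_between t p q"
proof -
  obtain a b where p: "p = (a, b)" by (cases p)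
  obtain c d where q: "q = (c, d)" by (cases q)
  obtain e f where s: "s = (e, f)" by (cases s)
  obtain g h where t: "t = (g, h)" by (cases t)
  show ?thesis
    using assms unfolding p q s t stands_between_iff fst_conv snd_conv prod.inject
    by (smt (verit))
qed

lemma between_closer:
  assumes "stands_between s p q"
  shows "\<bar>fst p - fst s\<bar> + \<bar>snd p - snd s\<bar> < \<bar>fst p - fst q\<bar> + \<bar>snd p - snd q\<bar>"
proof -
  have "fst s \<noteq> fst q \<or> snd s \<noteq> snd q"
    using assms by (auto simp: stands_between_iff prod_eq_iff)
  moreover have "min (fst p) (fst q) \<le> fst s \<and> fst s \<le> max (fst p) (fst q) \<and>
      min (snd p) (snd q) \<le> snd s \<and> snd s \<le> max (snd p) (snd q)"
    using assms by (simp add: stands_between_iff)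
  ultimately show ?thesis by (smt (verit))
qed

text \<open>
  Looking from \<open>p\<close> in the direction of another queen \<open>q\<close> one sees the nearest queen on that side.
  The induction replaces \<open>q\<close> by a queen in between as long as there is one.
\<close>
lemma attacks_towards:
  assumes "finite Q" "p \<in> Q" "q \<in> Q" "on_common_line p q"
  shows "\<exists>t. attack Q p t \<and> (t = q \<or> stands_between t p q)"
  using assms(3,4)
proof (induction "nat (\<bar>fst p - fst q\<bar> + \<bar>snd p - snd q\<bar>)" arbitrary: q rule: less_induct)
  case less
  show ?case
  proof (cases "\<exists>s\<in>Q. stands_between s p q")
    case False
    then show ?thesis using less.prems assms(2) unfolding attack_def by blast
  next
    case True
    then obtain s where s: "s \<in> Q" "stands_between s p q" by blast
    have "nat (\<bar>fst p - fst s\<bar> + \<bar>snd p - snd s\<bar>) < nat (\<bar>fst p - fst q\<bar> + \<bar>snd p - snd q\<bar>)"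
      using between_closer[OF s(2)] by linarith
    from less.hyps[OF this s(1) stands_between_lines(1)[OF s(2)]] s(2) stands_between_trans
    show ?thesis by blast
  qed
qed

text \<open>
  The queens that \<open>t\<close> sees on its two sides differ: the rectangles spanned by \<open>t, p\<close> and by
  \<open>t, q\<close> meet in \<open>t\<close> only.
\<close>
lemma between_opposite_sides:
  assumes "stands_between t p q" "u = p \<or> stands_between u t p" "v = q \<or> stands_between v t q"
  shows "u \<noteq> v"
proof
  assume "u = v"
  have in_rect: "min (fst t) (fst z) \<le> fst w \<and> fst w \<le> max (fst t) (fst z) \<and>
      min (snd t) (snd z) \<le> snd w \<and> snd w \<le> max (snd t) (snd z)"
    if "w = z \<or> stands_between w t z" for w z
    using that by (auto simp: stands_between_iff)
  have "min (fst p) (fst q) \<le> fst t \<and> fst t \<le> max (fst p) (fst q) \<and>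
      min (snd p) (snd q) \<le> snd t \<and> snd t \<le> max (snd p) (snd q)"
    using assms(1) by (simp add: stands_between_iff)
  then have "fst u = fst t" "snd u = snd t"
    using in_rect[OF assms(2)] in_rect[OF assms(3)] \<open>u = v\<close> by (smt (verit))+
  then have "u = t" by (simp add: prod_eq_iff)
  then show False using assms(1,2) by (auto simp: stands_between_iff)
qed

lemma card_le_oneI: "finite A \<Longrightarrow> (\<And>s t. s \<in> A \<Longrightarrow> t \<in> A \<Longrightarrow> s = t) \<Longrightarrow> card A \<le> 1"
  using card_le_Suc0_iff_eq[of A] by auto

lemma finite_board: "finite (board n)" by (simp add: board_def)

text \<open>
  A queen strictly between two others on a line would attack on both sides. Hence nothing stands between
  queens on a common line, every such pair attacks, and at most one attack per queen means at
  most one companion per queen.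
\<close>
lemma admissible_iff: "admissible n Q \<longleftrightarrow> Q \<subseteq> board n \<and> paired_at_most Q"
proof (intro iffI conjI)
  assume adm: "admissible n Q"
  then show sub: "Q \<subseteq> board n" by (simp add: admissible_def)
  then have fin: "finite Q" using finite_board finite_subset by blast
  have one: "t = t'" if "attack Q p t" "attack Q p t'" for p t t'
  proof -
    have "p \<in> Q" using that by (simp add: attack_def)
    then have "card {q. attack Q p q} \<le> 1" using adm by (simp add: admissible_def)
    moreover have "finite {q. attack Q p q}"
      by (rule finite_subset[OF _ fin]) (auto simp: attack_def)
    ultimately show ?thesis using that by (metis One_nat_def card_le_Suc0_iff_eq mem_Collect_eq)
  qed
  have no_between: False if h: "p \<in> Q" "q \<in> Q" "t \<in> Q" "stands_between t p q" for p q t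
  proof -
    have "on_common_line t p" using stands_between_lines(1)[OF h(4)] by (simp add: on_common_line_sym)
    then obtain u where u: "attack Q t u" "u = p \<or> stands_between u t p"
      using attacks_towards[OF fin h(3,1)] by blast
    obtain v where v: "attack Q t v" "v = q \<or> stands_between v t q"
      using attacks_towards[OF fin h(3,2) stands_between_lines(2)[OF h(4)]] by blast
    show False using one[OF u(1) v(1)] between_opposite_sides[OF h(4) u(2) v(2)] by blast
  qed
  have "q = s" if h: "p \<in> Q" "q \<in> Q" "s \<in> Q" "on_common_line p q" "on_common_line p s" for p q s
  proof -
    obtain t where t: "attack Q p t" "t = q \<or> stands_between t p q"
      using attacks_towards[OF fin h(1,2,4)] by blast
    obtain t' where t': "attack Q p t'" "t' = s \<or> stands_between t' p s"
      using attacks_towards[OF fin h(1,3,5)] by blast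
    have "t \<in> Q" "t' \<in> Q" using t(1) t'(1) by (auto simp: attack_def)
    then have "t = q" "t' = s"
      using t(2) t'(2) no_between[OF h(1,2), of t] no_between[OF h(1,3), of t'] by blast+
    then show ?thesis using one t t' by blast
  qed
  then show "paired_at_most Q" by (auto simp: paired_at_most_def)
next
  assume h: "Q \<subseteq> board n \<and> paired_at_most Q"
  have "card {q. attack Q p q} \<le> 1" if "p \<in> Q" for p
  proof -
    have "finite {q. attack Q p q}"
      by (rule finite_subset[OF _ finite_subset[OF _ finite_board]]) (use h in \<open>auto simp: attack_def\<close>)
    then show ?thesis
      by (rule card_le_oneI) (use h in \<open>auto simp: paired_at_most_def attack_def\<close>)
  qed
  then show "admissible n Q" using h by (simp add: admissible_def)
qed

text \<open>
  Every nonempty fibre of \<open>f\<close> contributes \<open>1\<close>. Below, \<open>f\<close> is the row or the column of a queen, and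
  the sum counts the occupied rows or columns.
\<close>
lemma sum_reciprocal_fibres:
  assumes "finite Q"
  shows "(\<Sum>p\<in>Q. 1 / real (card {q\<in>Q. f q = f p})) = real (card (f ` Q))"
proof -
  have "(\<Sum>p\<in>Q. 1 / real (card {q\<in>Q. f q = f p}))
      = (\<Sum>y\<in>f ` Q. \<Sum>p\<in>{p\<in>Q. f p = y}. 1 / real (card {q\<in>Q. f q = f p}))"
    by (rule sum.image_gen[OF assms])
  also have "\<dots> = (\<Sum>y\<in>f ` Q. 1)"
  proof (rule sum.cong[OF refl])
    fix y assume "y \<in> f ` Q"
    then have "card {q\<in>Q. f q = y} \<noteq> 0" using assms by (auto simp: card_eq_0_iff)
    then show "(\<Sum>p\<in>{p\<in>Q. f p = y}. 1 / real (card {q\<in>Q. f q = f p})) = 1" by simp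
  qed
  finally show ?thesis by simp
qed

text \<open>
  A queen has at most one companion in its row and column together, so one of the two
  numbers is \<open>1\<close> and the other at most \<open>2\<close>.
\<close>
lemma row_column_weight:
  assumes "finite Q" "paired_at_most Q" "p \<in> Q"
  shows "1 / real (card {q\<in>Q. fst q = fst p}) + 1 / real (card {q\<in>Q. snd q = snd p}) \<ge> 3 / 2"
proof -
  let ?R = "{q\<in>Q. fst q = fst p}" and ?C = "{q\<in>Q. snd q = snd p}"
  have "card ((?R \<union> ?C) - {p}) \<le> 1"
  proof -
    have "s \<in> Q \<and> on_common_line p s" if "s \<in> (?R \<union> ?C) - {p}" for s
      using that by (auto simp: on_common_line_iff)
    then have "s = t" if "s \<in> (?R \<union> ?C) - {p}" "t \<in> (?R \<union> ?C) - {p}" for s t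
      using that assms(2,3) unfolding paired_at_most_def by blast
    moreover have "finite ((?R \<union> ?C) - {p})" using assms(1) by simp
    ultimately show ?thesis using card_le_oneI by blast
  qed
  moreover have "card ((?R \<union> ?C) - {p}) = card (?R \<union> ?C) - 1"
    using assms(1,3) by (intro card_Diff_singleton) simp
  moreover have "card (?R \<union> ?C) + card (?R \<inter> ?C) = card ?R + card ?C"
    using card_Un_Int[of ?R ?C] assms(1) by simp
  moreover have "?R \<inter> ?C = {p}" using assms(3) by (auto simp: prod_eq_iff)
  ultimately have "card ?R + card ?C \<le> 3" by simp
  moreover have "finite ?R" "finite ?C" using assms(1) by simp_all
  then have "card ?R \<noteq> 0" "card ?C \<noteq> 0" using assms(3) card_0_eq by blast+
  ultimately have "(card ?R = 1 \<and> card ?C = 1) \<or> (card ?R = 1 \<and> card ?C = 2) \<or> (card ?R = 2 \<and> card ?C = 1)"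
    by linarith
  then show ?thesis by (elim disjE) simp_all
qed

lemma queens_le_four_thirds:
  assumes "admissible n Q"
  shows "3 * card Q \<le> 4 * n"
proof -
  have sub: "Q \<subseteq> board n" and pa: "paired_at_most Q" using assms by (auto simp: admissible_iff)
  have fin: "finite Q" using sub finite_board finite_subset by blast
  have "3 / 2 * real (card Q) = (\<Sum>p\<in>Q. 3 / 2)" by simp
  also have "\<dots> \<le> (\<Sum>p\<in>Q. 1 / real (card {q\<in>Q. fst q = fst p}) + 1 / real (card {q\<in>Q. snd q = snd p}))"
    by (intro sum_mono row_column_weight fin pa)
  also have "\<dots> = real (card (fst ` Q)) + real (card (snd ` Q))"
    by (simp add: sum.distrib sum_reciprocal_fibres[OF fin])
  also have "\<dots> \<le> real n + real n"
  proof -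
    have "fst ` Q \<subseteq> {1..int n}" "snd ` Q \<subseteq> {1..int n}" using sub by (auto simp: board_def)
    then have "card (fst ` Q) \<le> card {1..int n}" "card (snd ` Q) \<le> card {1..int n}"
      using card_mono[of "{1..int n}"] by blast+
    then show ?thesis by simp
  qed
  finally show ?thesis by simp
qed

section \<open>Configurations in which only rows and columns are shared\<close>

text \<open>
  All companions are found along rows and columns, where every queen has at most one; diagonals and
  antidiagonals carry at most one queen each. This loses nothing: if there are \<open>4 n / 3\<close> queens, then equality
  in \<open>row_column_weight\<close> gives every queen a companion in its row or column.
\<close>
definition rook_paired :: "cell set \<Rightarrow> bool" where
  "rook_paired Q \<longleftrightarrow> finite Q \<and>
     (\<forall>p\<in>Q. \<forall>q\<in>Q. \<forall>s\<in>Q. q \<noteq> p \<longrightarrow> s \<noteq> p \<longrightarrow>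
        fst p = fst q \<or> snd p = snd q \<longrightarrow> fst p = fst s \<or> snd p = snd s \<longrightarrow> q = s) \<and>
     inj_on diagonal Q \<and> inj_on antidiagonal Q"

text \<open>
  Boards are placed anywhere in the plane. Those of even size \<open>2 h\<close> sit in \<open>window (- h) h\<close>, with the
  centre at \<open>(1/2, 1/2)\<close>, so that a ring can be added without moving what is inside.
\<close>
definition window :: "int \<Rightarrow> int \<Rightarrow> cell set" where "window a b = {a<..b} \<times> {a<..b}"

lemma mem_window: "p \<in> window a b \<longleftrightarrow> a < fst p \<and> fst p \<le> b \<and> a < snd p \<and> snd p \<le> b"
  by (cases p) (auto simp: window_def)

lemma paired_of_rook_paired:
  assumes "rook_paired Q"
  shows "paired_at_most Q"
proof -
  have inj: "inj_on diagonal Q" "inj_on antidiagonal Q" using assms unfolding rook_paired_def by blast+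
  have rook: "fst p = fst q \<or> snd p = snd q" "q \<noteq> p" if "p \<in> Q" "q \<in> Q" "on_common_line p q" for p q
    using that(3) inj_onD[OF inj(1) _ that(1,2)] inj_onD[OF inj(2) _ that(1,2)]
    unfolding on_common_line_iff by blast+
  have "q = s" if h: "p \<in> Q" "q \<in> Q" "s \<in> Q" "on_common_line p q" "on_common_line p s" for p q s
    using assms h(1-3) rook[OF h(1,2,4)] rook[OF h(1,3,5)] unfolding rook_paired_def by metis
  then show ?thesis unfolding paired_at_most_def by blast
qed

text \<open>Two configurations with no line in common do not interact.\<close>
lemma rook_paired_Un:
  assumes "rook_paired A" "rook_paired B"
    and "\<And>p q. p \<in> A \<Longrightarrow> q \<in> B \<Longrightarrow> fst p \<noteq> fst q \<and> snd p \<noteq> snd q \<and> diagonal p \<noteq> diagonal q \<and> antidiagonal p \<noteq> antidiagonal q"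
  shows "rook_paired (A \<union> B)" "A \<inter> B = {}"
proof -
  have cross: "\<not> (fst p = fst q \<or> snd p = snd q)" "diagonal p \<noteq> diagonal q" "antidiagonal p \<noteq> antidiagonal q"
    if "p \<in> A \<and> q \<in> B \<or> p \<in> B \<and> q \<in> A" for p q
    using that assms(3)[of p q] assms(3)[of q p] by auto
  have "inj_on diagonal (A \<union> B)" "inj_on antidiagonal (A \<union> B)"
    using assms(1,2) cross(2,3) unfolding rook_paired_def inj_on_Un by fastforce+
  moreover have "finite (A \<union> B)" using assms unfolding rook_paired_def by simp
  moreover have "q = s" if h: "p \<in> A \<union> B" "q \<in> A \<union> B" "s \<in> A \<union> B" "q \<noteq> p" "s \<noteq> p"
    "fst p = fst q \<or> snd p = snd q" "fst p = fst s \<or> snd p = snd s" for p q s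
  proof -
    have "{p, q, s} \<subseteq> A \<or> {p, q, s} \<subseteq> B"
      using h cross(1)[of p q] cross(1)[of p s] by blast
    then show ?thesis using assms(1,2) h(4-) unfolding rook_paired_def by blast
  qed
  ultimately show "rook_paired (A \<union> B)" unfolding rook_paired_def by blast
  show "A \<inter> B = {}" using assms(3) by blast
qed

lemma paired_insert_pair:
  assumes "paired_at_most Q" "\<And>p. p \<in> Q \<Longrightarrow> \<not> on_common_line u p" "\<And>p. p \<in> Q \<Longrightarrow> \<not> on_common_line v p"
  shows "paired_at_most (insert u (insert v Q))"
proof -
  have irr: "\<not> on_common_line p p" for p by (simp add: on_common_line_iff)
  have "q = s" if h: "p \<in> insert u (insert v Q)" "q \<in> insert u (insert v Q)" "s \<in> insert u (insert v Q)"
    "on_common_line p q" "on_common_line p s" for p q s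
  proof (cases "p \<in> Q")
    case True
    then have "q \<in> Q" "s \<in> Q" using h assms(2,3) on_common_line_sym by blast+
    then show ?thesis using assms(1) h(4,5) True unfolding paired_at_most_def by blast
  next
    case False
    then have "p = u \<or> p = v" using h(1) by simp
    then show ?thesis
    proof
      assume "p = u"
      then have "q = v" "s = v" using h irr assms(2) by blast+
      then show ?thesis by simp
    next
      assume "p = v"
      then have "q = u" "s = u" using h irr assms(3) by blast+
      then show ?thesis by simp
    qed
  qed
  then show ?thesis unfolding paired_at_most_def by blast
qed

lemma admissible_of_window:
  assumes "paired_at_most Q" "Q \<subseteq> window a (a + int n)"
  shows "\<exists>Q'. admissible n Q' \<and> card Q' = card Q"
proof -
  define f :: "cell \<Rightarrow> cell" where "f p = (fst p - a, snd p - a)" for p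
  have inj: "inj f" by (auto simp: inj_def f_def prod_eq_iff)
  have "on_common_line (f p) (f q) \<longleftrightarrow> on_common_line p q" for p q
    by (auto simp: on_common_line_iff f_def prod_eq_iff)
  then have "paired_at_most (f ` Q)"
    using assms(1) unfolding paired_at_most_def by (simp add: inj_eq[OF inj])
  moreover have "f ` Q \<subseteq> board n" using assms(2) by (auto simp: f_def mem_window board_def)
  moreover have "card (f ` Q) = card Q" using inj by (metis card_image inj_on_subset subset_UNIV)
  ultimately show ?thesis by (auto simp: admissible_iff)
qed

text \<open>The extremal number of queens, \<open>4/3\<close> of the side length.\<close>
definition fills :: "int \<Rightarrow> int \<Rightarrow> cell set \<Rightarrow> bool" where
  "fills a b Q \<longleftrightarrow> rook_paired Q \<and> Q \<subseteq> window a b \<and> 3 * int (card Q) = 4 * (b - a)"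

text \<open>
  The cells next to two opposite corners of the window lie in new rows and columns and on new
  antidiagonals. The only line that they can share is the main diagonal, which carries no other
  queen; so two such queens only meet each other.
\<close>
lemma admissible_with_corners:
  assumes "fills a b Q" "a \<le> b" "\<And>p. p \<in> Q \<Longrightarrow> diagonal p \<noteq> 0" "n = nat (b - a)"
  shows "\<exists>Q'. admissible n Q' \<and> card Q' = card Q"
    and "\<exists>Q'. admissible (n + 1) Q' \<and> card Q' = card Q + 1"
    and "\<exists>Q'. admissible (n + 2) Q' \<and> card Q' = card Q + 2"
proof -
  have t: "rook_paired Q" and sub: "Q \<subseteq> window a b" and fin: "finite Q"
    using assms(1) unfolding fills_def rook_paired_def by blast+
  let ?u = "(a, a)" and ?v = "(b + 1, b + 1)"
  have n: "int n = b - a" using assms by simp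
  have win: "a < fst p" "fst p \<le> b" "a < snd p" "snd p \<le> b" if "p \<in> Q" for p
    using sub that by (auto simp: mem_window)
  have off: "\<not> on_common_line ?u p" "\<not> on_common_line ?v p" if "p \<in> Q" for p
    using assms(3)[OF that] win[OF that] unfolding on_common_line_iff fst_conv snd_conv by linarith+
  have notin: "?u \<notin> Q" "?v \<notin> Q" using win by fastforce+
  have ne: "?u \<noteq> ?v" using assms(2) by simp
  have paired: "paired_at_most Q" by (rule paired_of_rook_paired[OF t])
  have "Q \<subseteq> window a (a + int n)" using sub n by simp
  from admissible_of_window[OF paired this]
  show "\<exists>Q'. admissible n Q' \<and> card Q' = card Q" .
  have "paired_at_most (insert ?v Q)" using paired_insert_pair[OF paired off(2) off(2)] by simp
  moreover have "insert ?v Q \<subseteq> window a (a + int (n + 1))"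
    using win n assms(2) by (force simp: mem_window)
  moreover have "card (insert ?v Q) = card Q + 1" using fin notin by simp
  ultimately show "\<exists>Q'. admissible (n + 1) Q' \<and> card Q' = card Q + 1"
    using admissible_of_window by metis
  have "paired_at_most (insert ?u (insert ?v Q))" using paired_insert_pair[OF paired off] by simp
  moreover have "insert ?u (insert ?v Q) \<subseteq> window (a - 1) (a - 1 + int (n + 2))"
    using win n assms(2) by (force simp: mem_window)
  moreover have "card (insert ?u (insert ?v Q)) = card Q + 2" using fin notin ne by simp
  ultimately show "\<exists>Q'. admissible (n + 2) Q' \<and> card Q' = card Q + 2"
    using admissible_of_window by metis
qed

section \<open>Rosettes: boards from difference conditions on pairs\<close>

text \<open>
  The four images of the cell \<open>(x + 1, y + 1)\<close> under quarter turns about \<open>(1/2, 1/2)\<close>. The numbers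
  \<open>x, y \<ge> 0\<close> count rows and columns from the centre outwards, starting with \<open>0\<close>; so the number \<open>x\<close> belongs to the
  lines \<open>x + 1\<close> and \<open>- x\<close>.
\<close>
definition petal :: "nat \<Rightarrow> int \<times> int \<Rightarrow> cell" where
  "petal k p = (if k = 0 then (fst p + 1, snd p + 1) else if k = 1 then (- snd p, fst p + 1)
     else if k = 2 then (- fst p, - snd p) else (snd p + 1, - fst p))"

definition rosette :: "(int \<times> int) set \<Rightarrow> cell set" where
  "rosette P = (\<lambda>(k, p). petal k p) ` ({..<4} \<times> P)"

lemma petal_simps:
  "petal 0 p = (fst p + 1, snd p + 1)" "petal (Suc 0) p = (- snd p, fst p + 1)"
  "petal 2 p = (- fst p, - snd p)" "petal 3 p = (snd p + 1, - fst p)"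
  by (simp_all add: petal_def)

lemma less_four_cases: "(k::nat) < 4 \<Longrightarrow> k = 0 \<or> k = Suc 0 \<or> k = 2 \<or> k = 3" by linarith

text \<open>
  The conditions on pairs under which their rosette shares only rows and columns. They resemble a graceful
  labelling: a number \<open>x\<close> belongs to at most two pairs, a number \<open>y\<close> to one, and all the values \<open>\<bar>x - y\<bar>\<close> and
  \<open>x + y + 1\<close> are different.
\<close>
definition graceful :: "(int \<times> int) set \<Rightarrow> bool" where
  "graceful P \<longleftrightarrow> finite P \<and> (\<forall>p\<in>P. 0 \<le> fst p \<and> 0 \<le> snd p) \<and>
     fst ` P \<inter> snd ` P = {} \<and> inj_on snd P \<and>
     (\<forall>p\<in>P. \<forall>q\<in>P. \<forall>s\<in>P. fst p = fst q \<longrightarrow> fst p = fst s \<longrightarrow> q \<noteq> p \<longrightarrow> s \<noteq> p \<longrightarrow> q = s) \<and>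
     inj_on (\<lambda>p. \<bar>diagonal p\<bar>) P \<and> inj_on antidiagonal P \<and> (\<forall>p\<in>P. \<forall>q\<in>P. \<bar>diagonal p\<bar> \<noteq> antidiagonal q + 1)"

text \<open>
  Up to sign the diagonals and antidiagonals of the four petals are \<open>x - y\<close> and \<open>x + y + 1\<close>, and each sign occurs
  once; so they are different for different petals. Petals in a common row or column have the same
  index and the same \<open>x\<close>, because the numbers used as \<open>x\<close> are never used as \<open>y\<close>.
\<close>
lemma rook_paired_rosette:
  assumes "graceful P"
  shows "rook_paired (rosette P)" and "card (rosette P) = 4 * card P"
proof -
  have fin: "finite P" and nonneg: "\<And>p. p \<in> P \<Longrightarrow> 0 \<le> fst p \<and> 0 \<le> snd p"
    and disj: "\<And>p q. p \<in> P \<Longrightarrow> q \<in> P \<Longrightarrow> fst p \<noteq> snd q"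
    and snd_eq: "\<And>p q. p \<in> P \<Longrightarrow> q \<in> P \<Longrightarrow> snd p = snd q \<Longrightarrow> p = q"
    and three: "\<And>p q s. p \<in> P \<Longrightarrow> q \<in> P \<Longrightarrow> s \<in> P \<Longrightarrow> fst p = fst q \<Longrightarrow> fst p = fst s \<Longrightarrow> q \<noteq> p \<Longrightarrow> s \<noteq> p \<Longrightarrow> q = s"
    and dif_eq: "\<And>p q. p \<in> P \<Longrightarrow> q \<in> P \<Longrightarrow> \<bar>diagonal p\<bar> = \<bar>diagonal q\<bar> \<Longrightarrow> p = q"
    and sm_eq: "\<And>p q. p \<in> P \<Longrightarrow> q \<in> P \<Longrightarrow> antidiagonal p = antidiagonal q \<Longrightarrow> p = q"
    and cross: "\<And>p q. p \<in> P \<Longrightarrow> q \<in> P \<Longrightarrow> \<bar>diagonal p\<bar> \<noteq> antidiagonal q + 1"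
    using assms unfolding graceful_def inj_on_def by blast+
  have inj: "k = l \<and> p = q"
    if "k < 4" "l < 4" "p \<in> P" "q \<in> P" "diagonal (petal k p) = diagonal (petal l q) \<or> antidiagonal (petal k p) = antidiagonal (petal l q)"
    for k l p q
    using less_four_cases[OF that(1)] less_four_cases[OF that(2)] that(5)
      dif_eq[OF that(3,4)] sm_eq[OF that(3,4)] cross[OF that(3,4)] cross[OF that(4,3)]
      disj[OF that(3,3)] disj[OF that(4,4)] nonneg[OF that(3)] nonneg[OF that(4)]
    by (elim disjE; simp only: petal_simps fst_conv snd_conv) (smt (verit))+
  have rook: "k = l \<and> fst p = fst q"
    if "k < 4" "l < 4" "p \<in> P" "q \<in> P"
      "fst (petal k p) = fst (petal l q) \<or> snd (petal k p) = snd (petal l q)" for k l p q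
    using less_four_cases[OF that(1)] less_four_cases[OF that(2)] that(5)
      snd_eq[OF that(3,4)] disj[OF that(3,4)] disj[OF that(4,3)] nonneg[OF that(3)] nonneg[OF that(4)]
    by (elim disjE; simp only: petal_simps fst_conv snd_conv) (smt (verit))+
  have "inj_on (\<lambda>(k, p). petal k p) ({..<4} \<times> P)"
    by (rule inj_onI) (use inj in force)
  then show "card (rosette P) = 4 * card P"
    by (simp add: rosette_def card_image card_cartesian_product)
  have mem: "\<exists>k p. k < 4 \<and> p \<in> P \<and> c = petal k p" if "c \<in> rosette P" for c
    using that by (auto simp: rosette_def)
  have "inj_on diagonal (rosette P)" "inj_on antidiagonal (rosette P)"
    using mem inj unfolding inj_on_def by metis+
  moreover have "finite (rosette P)" using fin by (simp add: rosette_def)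
  moreover have "b = c"
    if h: "a \<in> rosette P" "b \<in> rosette P" "c \<in> rosette P" "b \<noteq> a" "c \<noteq> a"
      "fst a = fst b \<or> snd a = snd b" "fst a = fst c \<or> snd a = snd c" for a b c
  proof -
    obtain i p where a: "i < 4" "p \<in> P" "a = petal i p" using mem[OF h(1)] by blast
    obtain j q where b: "j < 4" "q \<in> P" "b = petal j q" using mem[OF h(2)] by blast
    obtain k s where c: "k < 4" "s \<in> P" "c = petal k s" using mem[OF h(3)] by blast
    have "i = j" "fst p = fst q" using rook[OF a(1) b(1) a(2) b(2)] h(6) a(3) b(3) by blast+
    moreover have "i = k" "fst p = fst s" using rook[OF a(1) c(1) a(2) c(2)] h(7) a(3) c(3) by blast+
    ultimately show ?thesis using three[OF a(2) b(2) c(2)] h(4,5) a b c by blast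
  qed
  ultimately show "rook_paired (rosette P)" unfolding rook_paired_def by blast
qed

text \<open>All that later arguments need to know about the position of a cell of a rosette.\<close>
lemma rosette_coordinates:
  assumes "c \<in> rosette P"
  obtains p where "p \<in> P"
    "\<bar>diagonal c\<bar> = \<bar>diagonal p\<bar> \<and> \<bar>antidiagonal c - 1\<bar> = \<bar>antidiagonal p + 1\<bar> \<or> \<bar>diagonal c\<bar> = \<bar>antidiagonal p + 1\<bar> \<and> \<bar>antidiagonal c - 1\<bar> = \<bar>diagonal p\<bar>"
    "fst c \<in> {fst p + 1, - fst p, snd p + 1, - snd p}"
    "snd c \<in> {fst p + 1, - fst p, snd p + 1, - snd p}"
proof -
  obtain k p where kp: "k < 4" "p \<in> P" "c = petal k p" using assms by (auto simp: rosette_def)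
  show ?thesis
  proof (rule that[OF kp(2)])
    show "\<bar>diagonal c\<bar> = \<bar>diagonal p\<bar> \<and> \<bar>antidiagonal c - 1\<bar> = \<bar>antidiagonal p + 1\<bar> \<or> \<bar>diagonal c\<bar> = \<bar>antidiagonal p + 1\<bar> \<and> \<bar>antidiagonal c - 1\<bar> = \<bar>diagonal p\<bar>"
      using less_four_cases[OF kp(1)] unfolding kp(3) by (elim disjE; simp only: petal_simps fst_conv snd_conv) linarith+
  qed (use less_four_cases[OF kp(1)] in \<open>auto simp: kp(3) petal_simps\<close>)
qed

text \<open>
  In a board of size \<open>6 m\<close>, diagonals are measured by their distance from the main diagonal, and
  antidiagonals, whose central one is \<open>1\<close>, by their distance from that one.
\<close>
definition gapped :: "int \<Rightarrow> int \<Rightarrow> bool" where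
  "gapped m g \<longleftrightarrow> (\<exists>Q. fills (- 3 * m) (3 * m) Q \<and> (\<forall>p\<in>Q. g \<le> \<bar>diagonal p\<bar> \<and> g \<le> \<bar>antidiagonal p - 1\<bar>))"

lemma gapped_of_graceful:
  assumes "graceful P" "int (card P) = 2 * m"
    and "\<And>p. p \<in> P \<Longrightarrow> fst p < 3 * m \<and> snd p < 3 * m \<and> g \<le> \<bar>diagonal p\<bar> \<and> g \<le> antidiagonal p + 1"
  shows "gapped m g"
proof -
  have nonneg: "0 \<le> fst p \<and> 0 \<le> snd p" if "p \<in> P" for p using assms(1) that unfolding graceful_def by blast
  have "c \<in> window (- 3 * m) (3 * m) \<and> g \<le> \<bar>diagonal c\<bar> \<and> g \<le> \<bar>antidiagonal c - 1\<bar>" if "c \<in> rosette P" for c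
  proof -
    obtain p where p: "p \<in> P"
      "\<bar>diagonal c\<bar> = \<bar>diagonal p\<bar> \<and> \<bar>antidiagonal c - 1\<bar> = \<bar>antidiagonal p + 1\<bar> \<or> \<bar>diagonal c\<bar> = \<bar>antidiagonal p + 1\<bar> \<and> \<bar>antidiagonal c - 1\<bar> = \<bar>diagonal p\<bar>"
      "fst c \<in> {fst p + 1, - fst p, snd p + 1, - snd p}"
      "snd c \<in> {fst p + 1, - fst p, snd p + 1, - snd p}"
      using rosette_coordinates[OF \<open>c \<in> rosette P\<close>] by blast
    have "c \<in> window (- 3 * m) (3 * m)"
      using p(3,4) nonneg[OF p(1)] assms(3)[OF p(1)] unfolding mem_window by auto
    then show ?thesis using p(2) assms(3)[OF p(1)] by linarith
  qed
  moreover have "3 * int (card (rosette P)) = 4 * (3 * m - (- 3 * m))"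
    using rook_paired_rosette(2)[OF assms(1)] assms(2) by simp
  ultimately show ?thesis
    using rook_paired_rosette(1)[OF assms(1)] unfolding gapped_def fills_def by blast
qed

text \<open>
  In a central square of side \<open>2 h\<close> all diagonals and antidiagonals have distance less than \<open>2 h\<close> from
  the centre. Queens outside avoid those of the square if they use new rows and columns
  and if each of their diagonals and antidiagonals lies in the gap or beyond \<open>2 h\<close>.
\<close>
lemma rook_paired_surround:
  assumes Q: "rook_paired Q" "Q \<subseteq> window (- h) h" "\<And>p. p \<in> Q \<Longrightarrow> g \<le> \<bar>diagonal p\<bar> \<and> g \<le> \<bar>antidiagonal p - 1\<bar>"
    and K: "rook_paired K" "\<And>p. p \<in> K \<Longrightarrow> fst p \<notin> {-h<..h} \<and> snd p \<notin> {-h<..h} \<and>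
        (\<bar>diagonal p\<bar> < g \<or> 2 * h \<le> \<bar>diagonal p\<bar>) \<and> (\<bar>antidiagonal p - 1\<bar> < g \<or> 2 * h \<le> \<bar>antidiagonal p - 1\<bar>)"
  shows "rook_paired (Q \<union> K)" "card (Q \<union> K) = card Q + card K"
proof -
  have far: "fst p \<noteq> fst q \<and> snd p \<noteq> snd q \<and> diagonal p \<noteq> diagonal q \<and> antidiagonal p \<noteq> antidiagonal q" if "p \<in> Q" "q \<in> K" for p q
    using Q(3)[OF that(1)] subsetD[OF Q(2) that(1)] K(2)[OF that(2)]
    unfolding mem_window greaterThanAtMost_iff by (smt (verit))
  show "rook_paired (Q \<union> K)" using rook_paired_Un(1)[OF Q(1) K(1) far] by blast
  have "Q \<inter> K = {}" using rook_paired_Un(2)[OF Q(1) K(1) far] by blast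
  then show "card (Q \<union> K) = card Q + card K"
    using Q(1) K(1) unfolding rook_paired_def by (intro card_Un_disjoint) blast+
qed

section \<open>Blowing a board up by a factor coprime to six\<close>

lemma coprime_step:
  fixes a b k p :: int
  assumes "p dvd k * (a - b)" "coprime k p" "a \<in> {0..<p}" "b \<in> {0..<p}"
  shows "a = b"
proof -
  have "p dvd a - b" using assms(1,2) by (simp add: coprime_commute coprime_dvd_mult_right_iff)
  then show ?thesis using assms(3,4) zdvd_imp_le[of p "a - b"] zdvd_imp_le[of p "b - a"]
    by (smt (verit) atLeastLessThan_iff dvd_minus_iff minus_diff_eq)
qed

lemma digits_unique:
  fixes p u v a b :: int
  assumes "p * u + a = p * v + b" "a \<in> {0..<p}" "b \<in> {0..<p}"
  shows "u = v" "a = b"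
proof -
  have "(p * u + a) div p = u" "(p * u + a) mod p = a" "(p * v + b) div p = v" "(p * v + b) mod p = b"
    using assms(2,3) by auto
  then show "u = v" "a = b" using assms(1) by auto
qed

text \<open>
  Modulo \<open>p\<close>, the row, column, diagonal and antidiagonal of a cell of the block are \<open>a\<close>, \<open>2 a\<close>, \<open>- a\<close> and
  \<open>3 a\<close>, up to constants. Hence two cells on a common line have the same position \<open>a\<close> in
  their blocks, and the blocks themselves are on a common line of the small board. A
  block spreads over \<open>2 p - 1\<close> diagonals, which diminishes the gap \<open>p g\<close> by \<open>p - 1\<close>.
\<close>
lemma gapped_blow_up:
  assumes "gapped m g" "0 < p" "coprime 2 p" "coprime 3 p"
  shows "gapped (p * m) (p * (g - 1) + 1)"
proof -
  obtain Q where Q: "fills (- 3 * m) (3 * m) Q" "\<And>q. q \<in> Q \<Longrightarrow> g \<le> \<bar>diagonal q\<bar> \<and> g \<le> \<bar>antidiagonal q - 1\<bar>"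
    using assms(1) unfolding gapped_def by blast
  have rook_paired: "rook_paired Q" and win: "Q \<subseteq> window (- 3 * m) (3 * m)" and card: "3 * int (card Q) = 4 * (3 * m - (- 3 * m))"
    using Q(1) unfolding fills_def by blast+
  define t where "t a = 2 * a mod p" for a
  define F where "F q a = (p * (fst q - 1) + 1 + a, p * (snd q - 1) + 1 + t a)" for q :: cell and a
  define Q' where "Q' = (\<lambda>(q, a). F q a) ` (Q \<times> {0..<p})"
  have t: "t a \<in> {0..<p}" for a using assms(2) by (simp add: t_def)
  have t_mod: "p dvd 2 * a - t a" for a unfolding t_def by (rule dvd_minus_mod)
  have t_mod2: "p dvd p * x + ((2 * a - t a) - (2 * b - t b))" for a b x
    by (rule dvd_add[OF dvd_triv_left dvd_diff[OF t_mod t_mod]])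
  have t_inj: "a = b" if "a \<in> {0..<p}" "b \<in> {0..<p}" "t a = t b" for a b
  proof -
    have "p dvd 2 * (a - b)" using t_mod2[of 0 a b] that(3) by (simp add: algebra_simps)
    then show ?thesis using coprime_step assms(3) that by blast
  qed
  \<comment> \<open>Both are written relative to the centre, so that the deviation from \<open>p\<close> times the old value is below \<open>p\<close>.\<close>
  have dif_F: "diagonal (F q a) = p * diagonal q + (a - t a)" and sm_F: "antidiagonal (F q a) = p * (antidiagonal q - 1) + (a + t a - p) + 2" for q a
    by (simp_all add: F_def algebra_simps)
  have diag: "q = r \<and> a = b"
    if h: "q \<in> Q" "r \<in> Q" "a \<in> {0..<p}" "b \<in> {0..<p}"
      "diagonal (F q a) = diagonal (F r b) \<or> antidiagonal (F q a) = antidiagonal (F r b)" for q r a b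
    using h(5)
  proof
    assume e: "diagonal (F q a) = diagonal (F r b)"
    have "1 * (a - b) = p * (diagonal q - diagonal r) + ((2 * a - t a) - (2 * b - t b))"
      using e unfolding dif_F by (simp add: algebra_simps)
    then have "p dvd 1 * (a - b)" using t_mod2 by metis
    then have "a = b" using coprime_step[of p 1 a b] h(3,4) by simp
    then have "diagonal q = diagonal r" using e assms(2) unfolding dif_F by simp
    then show ?thesis using rook_paired h(1,2) \<open>a = b\<close> unfolding rook_paired_def inj_on_def by blast
  next
    assume e: "antidiagonal (F q a) = antidiagonal (F r b)"
    have "3 * (a - b) = p * (antidiagonal r - antidiagonal q) + ((2 * a - t a) - (2 * b - t b))"
      using e unfolding sm_F by (simp add: algebra_simps)
    then have "p dvd 3 * (a - b)" using t_mod2 by metis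
    then have "a = b" using coprime_step assms(4) h(3,4) by blast
    then have "antidiagonal q = antidiagonal r" using e assms(2) unfolding sm_F by simp
    then show ?thesis using rook_paired h(1,2) \<open>a = b\<close> unfolding rook_paired_def inj_on_def by blast
  qed
  have rook: "a = b \<and> (fst q = fst r \<or> snd q = snd r)"
    if h: "a \<in> {0..<p}" "b \<in> {0..<p}" "fst (F q a) = fst (F r b) \<or> snd (F q a) = snd (F r b)" for q r a b
    using h(3)
  proof
    assume "fst (F q a) = fst (F r b)"
    then have "p * (fst q - 1) + a = p * (fst r - 1) + b" by (simp add: F_def)
    from digits_unique[OF this h(1,2)] show ?thesis by simp
  next
    assume "snd (F q a) = snd (F r b)"
    then have "p * (snd q - 1) + t a = p * (snd r - 1) + t b" by (simp add: F_def)
    from digits_unique[OF this t t] t_inj[OF h(1,2)] show ?thesis by simp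
  qed
  have mem: "\<exists>q a. q \<in> Q \<and> a \<in> {0..<p} \<and> c = F q a" if "c \<in> Q'" for c
    using that unfolding Q'_def by fast
  have "finite Q" using rook_paired unfolding rook_paired_def by blast
  then have "finite Q'" unfolding Q'_def by simp
  moreover have "inj_on diagonal Q'" "inj_on antidiagonal Q'"
    using mem diag unfolding inj_on_def by metis+
  moreover have "d = e"
    if h: "c \<in> Q'" "d \<in> Q'" "e \<in> Q'" "d \<noteq> c" "e \<noteq> c"
      "fst c = fst d \<or> snd c = snd d" "fst c = fst e \<or> snd c = snd e" for c d e
  proof -
    obtain q a where c: "q \<in> Q" "a \<in> {0..<p}" "c = F q a" using mem[OF h(1)] by blast
    obtain r b where d: "r \<in> Q" "b \<in> {0..<p}" "d = F r b" using mem[OF h(2)] by blast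
    obtain s i where e: "s \<in> Q" "i \<in> {0..<p}" "e = F s i" using mem[OF h(3)] by blast
    have 1: "a = b" "fst q = fst r \<or> snd q = snd r" using rook[OF c(2) d(2)] h(6) c(3) d(3) by blast+
    have 2: "a = i" "fst q = fst s \<or> snd q = snd s" using rook[OF c(2) e(2)] h(7) c(3) e(3) by blast+
    have "r \<noteq> q" "s \<noteq> q" using 1(1) 2(1) h(4,5) c(3) d(3) e(3) by blast+
    then have "r = s" using rook_paired c(1) d(1) e(1) 1(2) 2(2) unfolding rook_paired_def by blast
    then show ?thesis using 1(1) 2(1) d(3) e(3) by blast
  qed
  ultimately have "rook_paired Q'" unfolding rook_paired_def by blast
  moreover have "c \<in> window (- 3 * (p * m)) (3 * (p * m)) \<and>
      p * (g - 1) + 1 \<le> \<bar>diagonal c\<bar> \<and> p * (g - 1) + 1 \<le> \<bar>antidiagonal c - 1\<bar>" if c': "c \<in> Q'" for c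
  proof -
    obtain q a where c: "q \<in> Q" "a \<in> {0..<p}" "c = F q a" using mem[OF c'] by blast
    \<comment> \<open>The shrinking of the gap: \<open>p \<bar>x\<bar> - (p - 1) \<ge> p g - (p - 1)\<close>.\<close>
    have large: "p * (g - 1) + 1 \<le> \<bar>p * x + y\<bar>" if "g \<le> \<bar>x\<bar>" "\<bar>y\<bar> < p" for x y
    proof -
      have "p * g \<le> p * \<bar>x\<bar>" using that(1) assms(2) by simp
      also have "\<dots> = \<bar>p * x\<bar>" using assms(2) by (simp add: abs_mult)
      finally show ?thesis using that(2) by (simp add: algebra_simps)
    qed
    have inside: "- 3 * (p * m) < p * (x - 1) + 1 + y \<and> p * (x - 1) + 1 + y \<le> 3 * (p * m)"
      if "- 3 * m < x" "x \<le> 3 * m" "y \<in> {0..<p}" for x y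
    proof -
      have "p * (- 3 * m) \<le> p * (x - 1)" "p * (x - 1) \<le> p * (3 * m - 1)"
        by (rule mult_left_mono; use that(1,2) assms(2) in simp)+
      moreover have "p * (- 3 * m) = - 3 * (p * m)" "p * (3 * m - 1) = 3 * (p * m) - p"
        by (simp_all add: algebra_simps)
      ultimately show ?thesis using that(3) unfolding atLeastLessThan_iff by linarith
    qed
    have "\<bar>a - t a\<bar> < p" "\<bar>(a + t a - p) + 1\<bar> < p" using c(2) t[of a] by auto
    moreover have "antidiagonal c - 1 = p * (antidiagonal q - 1) + ((a + t a - p) + 1)" unfolding c(3) sm_F by simp
    moreover have "- 3 * m < fst q" "fst q \<le> 3 * m" "- 3 * m < snd q" "snd q \<le> 3 * m"
      using subsetD[OF win c(1)] unfolding mem_window by blast+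
    ultimately show ?thesis
      using large[of "diagonal q" "a - t a"] large[of "antidiagonal q - 1" "(a + t a - p) + 1"] Q(2)[OF c(1)]
        inside[of "fst q" a] inside[of "snd q" "t a"] c(2) t[of a]
      unfolding mem_window c(3) dif_F by (simp add: F_def)
  qed
  moreover have "3 * int (card Q') = 4 * (3 * (p * m) - (- 3 * (p * m)))"
  proof -
    have "inj_on (\<lambda>(q, a). F q a) (Q \<times> {0..<p})"
    proof (rule inj_onI)
      fix x y assume "x \<in> Q \<times> {0..<p}" "y \<in> Q \<times> {0..<p}" "(\<lambda>(q, a). F q a) x = (\<lambda>(q, a). F q a) y"
      then show "x = y" using diag[of "fst x" "fst y" "snd x" "snd y"] by (auto simp: prod_eq_iff)
    qed
    then have "int (card Q') = int (card Q) * p"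
      using assms(2) by (simp add: Q'_def card_image card_cartesian_product)
    then show ?thesis using card by (simp add: algebra_simps)
  qed
  ultimately show ?thesis unfolding gapped_def fills_def by blast
qed

text \<open>
  Moving all pairs outwards by \<open>h\<close> keeps \<open>\<bar>x - y\<bar>\<close> and makes \<open>x + y + 1\<close> larger than all of these
  values. So in a frame each kind of values has to be compared with itself only.
\<close>
lemma graceful_shift:
  assumes "finite P" "\<And>p. p \<in> P \<Longrightarrow> 0 \<le> fst p \<and> 0 \<le> snd p"
    "fst ` P \<inter> snd ` P = {}" "inj_on snd P"
    "\<And>p q s. p \<in> P \<Longrightarrow> q \<in> P \<Longrightarrow> s \<in> P \<Longrightarrow> fst p = fst q \<Longrightarrow> fst p = fst s \<Longrightarrow> q \<noteq> p \<Longrightarrow> s \<noteq> p \<Longrightarrow> q = s"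
    "inj_on (\<lambda>p. \<bar>diagonal p\<bar>) P" "inj_on antidiagonal P" "\<And>p. p \<in> P \<Longrightarrow> \<bar>diagonal p\<bar> < 2 * h" "0 \<le> h"
  shows "graceful ((\<lambda>p. (fst p + h, snd p + h)) ` P)"
proof -
  let ?f = "\<lambda>p. (fst p + h, snd p + h)"
  have mem: "\<exists>p\<in>P. c = ?f p" if "c \<in> ?f ` P" for c using that by blast
  have cross: "\<bar>diagonal p\<bar> \<noteq> antidiagonal q + 2 * h + 1" if "p \<in> P" "q \<in> P" for p q
    using assms(2)[OF that(2)] assms(8)[OF that(1)] assms(9) by linarith
  have disj: "fst c \<noteq> snd d" if h: "c \<in> ?f ` P" "d \<in> ?f ` P" for c d
  proof -
    obtain p q where pq: "p \<in> P" "q \<in> P" "c = ?f p" "d = ?f q" using h by blast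
    then have "fst p \<noteq> snd q" using assms(3) by (metis disjoint_iff image_eqI)
    then show ?thesis using pq(3,4) by simp
  qed
  show ?thesis
    unfolding graceful_def
  proof (intro conjI ballI impI)
    show "finite (?f ` P)" using assms(1) by simp
    show "0 \<le> fst c" "0 \<le> snd c" if "c \<in> ?f ` P" for c using that assms(2,9) by fastforce+
    show "fst ` ?f ` P \<inter> snd ` ?f ` P = {}" using disj by blast
    show "inj_on snd (?f ` P)"
      by (rule inj_on_imageI, rule inj_onI) (use inj_onD[OF assms(4)] in simp)
    show "inj_on (\<lambda>c. \<bar>diagonal c\<bar>) (?f ` P)"
      by (rule inj_on_imageI, rule inj_onI) (use inj_onD[OF assms(6)] in simp)
    show "inj_on antidiagonal (?f ` P)"
      by (rule inj_on_imageI, rule inj_onI) (use inj_onD[OF assms(7)] in simp)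
    show "\<bar>diagonal c\<bar> \<noteq> antidiagonal d + 1" if h: "c \<in> ?f ` P" "d \<in> ?f ` P" for c d
    proof -
      obtain p q where "p \<in> P" "q \<in> P" "c = ?f p" "d = ?f q" using h by blast
      then show ?thesis using cross[of p q] by simp
    qed
    show "d = e" if g: "c \<in> ?f ` P" "d \<in> ?f ` P" "e \<in> ?f ` P" "fst c = fst d" "fst c = fst e" "d \<noteq> c" "e \<noteq> c" for c d e
    proof -
      obtain p q s where pqs: "p \<in> P" "q \<in> P" "s \<in> P" "c = ?f p" "d = ?f q" "e = ?f s" using g(1-3) by blast
      then have "fst p = fst q" "fst p = fst s" "q \<noteq> p" "s \<noteq> p" using g(4-) by auto
      then show ?thesis using assms(5)[OF pqs(1-3)] pqs(5,6) by blast
    qed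
  qed
qed

section \<open>Triples as data for boards and for frames\<close>

text \<open>A list of triples \<open>x, y, y'\<close> is written without brackets; \<open>x\<close> is paired with \<open>y\<close> and with \<open>y'\<close>.\<close>
fun pairs_of :: "int list \<Rightarrow> (int \<times> int) list" where
  "pairs_of (x # y # z # zs) = (x, y) # (x, z) # pairs_of zs"
| "pairs_of _ = []"

lemma set_pairs_of: "p \<in> set (pairs_of zs) \<Longrightarrow> fst p \<in> set zs \<and> snd p \<in> set zs"
  by (induction zs rule: pairs_of.induct) auto

lemma length_pairs_of: "3 dvd length zs \<Longrightarrow> 3 * length (pairs_of zs) = 2 * length zs"
proof (induction zs rule: pairs_of.induct)
  case (1 x y z zs)
  have "3 dvd length zs" using 1(2) unfolding list.size by presburger
  then show ?case using 1(1) by simp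
qed (auto dest!: dvd_imp_le)

lemma pairs_of_distinct:
  assumes "distinct zs"
  shows "fst ` set (pairs_of zs) \<inter> snd ` set (pairs_of zs) = {}"
    and "inj_on snd (set (pairs_of zs))"
    and "\<And>p q s. p \<in> set (pairs_of zs) \<Longrightarrow> q \<in> set (pairs_of zs) \<Longrightarrow> s \<in> set (pairs_of zs) \<Longrightarrow>
       fst p = fst q \<Longrightarrow> fst p = fst s \<Longrightarrow> q \<noteq> p \<Longrightarrow> s \<noteq> p \<Longrightarrow> q = s"
    and "distinct (pairs_of zs)"
  using assms
proof (induction zs rule: pairs_of.induct)
  case (1 x y z zs)
  {
    case 1
    have "\<And>p. p \<in> set (pairs_of zs) \<Longrightarrow> fst p \<in> set zs \<and> snd p \<in> set zs" by (rule set_pairs_of)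
    then have "fst ` set (pairs_of zs) \<subseteq> set zs" "snd ` set (pairs_of zs) \<subseteq> set zs" by blast+
    moreover have "fst ` set (pairs_of zs) \<inter> snd ` set (pairs_of zs) = {}" using "1.IH"(1) 1 by simp
    ultimately show ?case using 1 by auto
  next
    case 2
    have "\<And>p. p \<in> set (pairs_of zs) \<Longrightarrow> fst p \<in> set zs \<and> snd p \<in> set zs" by (rule set_pairs_of)
    then have "snd ` set (pairs_of zs) \<subseteq> set zs" by blast
    then show ?case using 2 "1.IH"(2) by (auto simp: inj_on_def) 
  next
    case (3 p q s)
    have old: "fst p \<noteq> x" if "p \<in> set (pairs_of zs)" for p using set_pairs_of[OF that] 3 by auto
    have new: "p = (x, y) \<or> p = (x, z)" if "p \<in> set (pairs_of (x # y # z # zs))" "fst p = x" for p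
      using that old[of p] by auto
    show ?case
    proof (cases "fst p = x")
      case True
      then show ?thesis using new[of p] new[of q] new[of s] 3 by metis
    next
      case False
      then have "fst q \<noteq> x" "fst s \<noteq> x" using 3(4,5) by simp_all
      then have "p \<in> set (pairs_of zs)" "q \<in> set (pairs_of zs)" "s \<in> set (pairs_of zs)"
        using 3(1-3) False by fastforce+
      moreover have "distinct zs" using 3(8) by simp
      ultimately show ?thesis using "1.IH"(3) 3(4-7) by blast
    qed
  next
    case 4
    have "\<And>p. p \<in> set (pairs_of zs) \<Longrightarrow> fst p \<in> set zs \<and> snd p \<in> set zs" by (rule set_pairs_of)
    then have "(x, u) \<notin> set (pairs_of zs)" for u using 4 by force
    then show ?case using 4 "1.IH"(4) by simp
  }
qed auto

text \<open>
  Merge sort brings a test for repeated entries from quadratic to nearly linear cost, which matters for the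
  evaluation of long lists by rewriting.
\<close>
fun merge :: "int list \<Rightarrow> int list \<Rightarrow> int list" where
  "merge [] ys = ys"
| "merge xs [] = xs"
| "merge (x # xs) (y # ys) = (if x < y then x # merge xs (y # ys) else y # merge (x # xs) ys)"

fun merge_pairs :: "int list list \<Rightarrow> int list list" where
  "merge_pairs (xs # ys # zss) = merge xs ys # merge_pairs zss"
| "merge_pairs xss = xss"

lemma length_merge_pairs: "length (merge_pairs xss) \<le> length xss"
  by (induction xss rule: merge_pairs.induct) auto

function merge_all :: "int list list \<Rightarrow> int list" where
  "merge_all [] = []"
| "merge_all [xs] = xs"
| "merge_all (xs # ys # zss) = merge_all (merge_pairs (xs # ys # zss))"
  by pat_completeness auto
termination
  by (relation "measure length") (auto simp: le_imp_less_Suc length_merge_pairs)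

lemma merge_contents: "set (merge xs ys) = set xs \<union> set ys" "length (merge xs ys) = length xs + length ys"
  by (induction xs ys rule: merge.induct) auto

lemma merge_pairs_contents:
  "set (concat (merge_pairs xss)) = set (concat xss)" "length (concat (merge_pairs xss)) = length (concat xss)"
  by (induction xss rule: merge_pairs.induct) (auto simp: merge_contents)

lemma merge_all_contents:
  "set (merge_all xss) = set (concat xss) \<and> length (merge_all xss) = length (concat xss)"
proof (induction xss rule: merge_all.induct)
  case (3 xs ys zss)
  then show ?case using merge_pairs_contents[of "xs # ys # zss"] by (simp only: merge_all.simps)
qed simp_all

definition all_different :: "int list \<Rightarrow> bool" where
  "all_different xs \<longleftrightarrow> successively (<) (merge_all (map (\<lambda>x. [x]) xs))"

text \<open>Sorting keeps length and elements, so a strictly increasing result leaves no room for repetitions.\<close>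
lemma all_different_distinct:
  assumes "all_different xs"
  shows "distinct xs"
proof -
  let ?ys = "merge_all (map (\<lambda>x. [x]) xs)"
  have "sorted_wrt (<) ?ys"
    using assms unfolding all_different_def by (simp add: successively_conv_sorted_wrt)
  then have "card (set ?ys) = length ?ys" by (simp add: strict_sorted_iff distinct_card)
  moreover have "concat (map (\<lambda>x. [x]) xs) = xs" by (induction xs) simp_all
  ultimately show ?thesis using merge_all_contents[of "map (\<lambda>x. [x]) xs"] card_distinct by metis
qed

definition triples_filling :: "int \<Rightarrow> int list \<Rightarrow> bool" where
  "triples_filling m zs \<longleftrightarrow> int (length zs) = 3 * m \<and> all_different zs \<and> (\<forall>z\<in>set zs. 0 \<le> z \<and> z < 3 * m)"

lemma distinct_of_filling: "triples_filling m zs \<Longrightarrow> distinct zs"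
  unfolding triples_filling_def using all_different_distinct by blast

text \<open>
  Decidable forms of the conditions under which triples yield a board with gap \<open>g\<close>, and a frame that uses only
  the central lines at distances \<open>g\<close> to \<open>u\<close>. The second is weaker apart from the bound \<open>u\<close>, in
  accordance with the shift above.
\<close>
definition gapped_triples :: "int \<times> int \<times> int list \<Rightarrow> bool" where
  "gapped_triples = (\<lambda>(m, g, zs). triples_filling m zs \<and>
     (let vs = concat (map (\<lambda>(x, y). [\<bar>x - y\<bar>, x + y + 1]) (pairs_of zs))
      in all_different vs \<and> (\<forall>v\<in>set vs. g \<le> v)))"

definition frame_triples :: "int \<times> int \<times> int \<times> int list \<Rightarrow> bool" where
  "frame_triples = (\<lambda>(m, g, u, zs). triples_filling m zs \<and>
     (let ds = map (\<lambda>(x, y). \<bar>x - y\<bar>) (pairs_of zs)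
      in distinct ds \<and> (\<forall>d\<in>set ds. g \<le> d \<and> d \<le> u)) \<and>
     distinct (map (\<lambda>(x, y). x + y) (pairs_of zs)))"

lemma card_pairs_of:
  assumes "triples_filling m zs"
  shows "int (card (set (pairs_of zs))) = 2 * m"
proof -
  have "3 dvd int (length zs)" using assms unfolding triples_filling_def by (metis dvd_triv_left)
  then have "3 dvd length zs" by presburger
  then have "3 * length (pairs_of zs) = 2 * length zs" by (rule length_pairs_of)
  moreover have "card (set (pairs_of zs)) = length (pairs_of zs)"
    using pairs_of_distinct(4)[OF distinct_of_filling[OF assms]] distinct_card by blast
  ultimately show ?thesis using assms unfolding triples_filling_def by linarith
qed

lemma triples_filling_range:
  assumes "triples_filling m zs" "p \<in> set (pairs_of zs)"
  shows "0 \<le> fst p \<and> fst p < 3 * m \<and> 0 \<le> snd p \<and> snd p < 3 * m"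
  using assms set_pairs_of unfolding triples_filling_def by blast

lemma distinct_concat_pairs:
  assumes "distinct (concat (map (\<lambda>(x, y). [f x y, h x y]) ps))" "distinct ps"
  shows "inj_on (\<lambda>p. f (fst p) (snd p)) (set ps)" "inj_on (\<lambda>p. h (fst p) (snd p)) (set ps)"
    "\<And>p q. p \<in> set ps \<Longrightarrow> q \<in> set ps \<Longrightarrow> f (fst p) (snd p) \<noteq> h (fst q) (snd q)"
  using assms
proof (induction ps)
  case (Cons a ps)
  obtain x y where a: "a = (x, y)" by (cases a)
  {
    case 1
    then show ?case using Cons.IH(1) unfolding a by (force simp: inj_on_def)
  next
    case 2
    then show ?case using Cons.IH(2) unfolding a by (force simp: inj_on_def)
  next
    case (3 p q)
    let ?c = "concat (map (\<lambda>(x, y). [f x y, h x y]) ps)"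
    have mem: "f (fst r) (snd r) \<in> set ?c \<and> h (fst r) (snd r) \<in> set ?c" if "r \<in> set ps" for r
      using that by force
    have new: "f x y \<noteq> h x y" "f x y \<notin> set ?c" "h x y \<notin> set ?c" "distinct ?c" "distinct ps"
      using 3(3,4) unfolding a by simp_all
    consider "p = a" "q = a" | "p = a" "q \<in> set ps" | "p \<in> set ps" "q = a" | "p \<in> set ps" "q \<in> set ps"
      using 3(1,2) by auto
    then show ?case
    proof cases
      case 1 then show ?thesis using new(1) a by simp
    next
      case 2 then show ?thesis using new(2) mem[of q] a by auto
    next
      case 3 then show ?thesis using new(3) mem[of p] a by auto
    next
      case 4 then show ?thesis using Cons.IH(3) new(4,5) by blast
    qed
  }
qed auto

lemma gapped_of_triples:
  assumes "gapped_triples (m, g, zs)"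
  shows "gapped m g"
proof -
  let ?P = "set (pairs_of zs)"
  let ?vs = "concat (map (\<lambda>(x, y). [\<bar>x - y\<bar>, x + y + 1]) (pairs_of zs))"
  have triples_filling: "triples_filling m zs" and diff: "all_different ?vs" and large: "\<forall>v\<in>set ?vs. g \<le> v"
    using assms by (auto simp: gapped_triples_def Let_def)
  have dist: "distinct ?vs" by (rule all_different_distinct[OF diff])
  have zs: "distinct zs" by (rule distinct_of_filling[OF triples_filling])
  note vals = distinct_concat_pairs[OF dist pairs_of_distinct(4)[OF zs]]
  have "graceful ?P"
    unfolding graceful_def
  proof (intro conjI ballI impI)
    show "finite ?P" by simp
    show "0 \<le> fst p" "0 \<le> snd p" if "p \<in> ?P" for p using triples_filling_range[OF triples_filling that] by blast+
    show "fst ` ?P \<inter> snd ` ?P = {}" "inj_on snd ?P" by (rule pairs_of_distinct[OF zs])+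
    show "inj_on (\<lambda>p. \<bar>diagonal p\<bar>) ?P" using vals(1) .
    show "inj_on antidiagonal ?P" using vals(2) by (simp add: inj_on_def)
    show "\<bar>diagonal p\<bar> \<noteq> antidiagonal q + 1" if "p \<in> ?P" "q \<in> ?P" for p q using vals(3)[OF that] .
    show "q = s" if "p \<in> ?P" "q \<in> ?P" "s \<in> ?P" "fst p = fst q" "fst p = fst s" "q \<noteq> p" "s \<noteq> p" for p q s
      using pairs_of_distinct(3)[OF zs that] .
  qed
  moreover have "fst p < 3 * m \<and> snd p < 3 * m \<and> g \<le> \<bar>diagonal p\<bar> \<and> g \<le> antidiagonal p + 1" if "p \<in> ?P" for p
    using triples_filling_range[OF triples_filling that] large that by (cases p) force
  ultimately show ?thesis using gapped_of_graceful card_pairs_of[OF triples_filling] by blast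
qed

text \<open>
  The numbers of the frame are shifted by \<open>3 n\<close>, half the size of the inner board. The
  frame occupies central lines between \<open>g'\<close> and \<open>u\<close>, inside the gap \<open>g\<close>, so that a gap
  \<open>g'\<close> remains.
\<close>
lemma gapped_frame:
  assumes "gapped n g" "frame_triples (m, g', u, zs)" "u < g" "g' \<le> g" "0 < n"
  shows "gapped (n + m) g'"
proof -
  let ?P = "set (pairs_of zs)" and ?f = "\<lambda>p. (fst p + 3 * n, snd p + 3 * n)"
  obtain Q where Q: "fills (- 3 * n) (3 * n) Q" "\<And>q. q \<in> Q \<Longrightarrow> g \<le> \<bar>diagonal q\<bar> \<and> g \<le> \<bar>antidiagonal q - 1\<bar>"
    using assms(1) unfolding gapped_def by blast
  have rook_paired: "rook_paired Q" and win: "Q \<subseteq> window (- (3 * n)) (3 * n)" and card: "3 * int (card Q) = 4 * (3 * n - (- 3 * n))"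
    using Q(1) unfolding fills_def by simp_all
  have triples_filling: "triples_filling m zs" and dist: "distinct (map (\<lambda>(x, y). \<bar>x - y\<bar>) (pairs_of zs))"
      "distinct (map (\<lambda>(x, y). x + y) (pairs_of zs))"
    and bound: "\<And>p. p \<in> ?P \<Longrightarrow> g' \<le> \<bar>diagonal p\<bar> \<and> \<bar>diagonal p\<bar> \<le> u"
    using assms(2) by (auto simp: frame_triples_def Let_def)
  have zs: "distinct zs" by (rule distinct_of_filling[OF triples_filling])
  have inj: "inj_on (\<lambda>p. \<bar>diagonal p\<bar>) ?P" "inj_on antidiagonal ?P"
    using dist by (simp_all add: distinct_map split_def)
  \<comment> \<open>A nonempty board cannot have a gap that exceeds its own width; this bounds \<open>u\<close>.\<close>
  have "g < 6 * n"
  proof -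
    have "Q \<noteq> {}" using card assms(5) by auto
    then obtain q where "q \<in> Q" by blast
    then show ?thesis using Q(2)[of q] subsetD[OF win, of q] unfolding mem_window by linarith
  qed
  then have small: "\<bar>diagonal p\<bar> < 2 * (3 * n)" if "p \<in> ?P" for p
    using bound[OF that] assms(3) by linarith
  have nonneg: "0 \<le> fst p \<and> 0 \<le> snd p" if "p \<in> ?P" for p
    using triples_filling_range[OF triples_filling that] by blast
  have graceful: "graceful (?f ` ?P)"
    by (rule graceful_shift[OF _ nonneg pairs_of_distinct(1,2,3)[OF zs] inj small])
      (use assms(5) in simp_all)
  let ?K = "rosette (?f ` ?P)"
  have K: "(fst c \<notin> {- (3 * n)<..3 * n} \<and> snd c \<notin> {- (3 * n)<..3 * n} \<and>
      (\<bar>diagonal c\<bar> < g \<or> 2 * (3 * n) \<le> \<bar>diagonal c\<bar>) \<and> (\<bar>antidiagonal c - 1\<bar> < g \<or> 2 * (3 * n) \<le> \<bar>antidiagonal c - 1\<bar>)) \<and>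
      g' \<le> \<bar>diagonal c\<bar> \<and> g' \<le> \<bar>antidiagonal c - 1\<bar> \<and> c \<in> window (- 3 * (n + m)) (3 * (n + m))"
    if c: "c \<in> ?K" for c
  proof -
    obtain p' where p': "p' \<in> ?f ` ?P"
      "\<bar>diagonal c\<bar> = \<bar>diagonal p'\<bar> \<and> \<bar>antidiagonal c - 1\<bar> = \<bar>antidiagonal p' + 1\<bar> \<or> \<bar>diagonal c\<bar> = \<bar>antidiagonal p' + 1\<bar> \<and> \<bar>antidiagonal c - 1\<bar> = \<bar>diagonal p'\<bar>"
      "fst c \<in> {fst p' + 1, - fst p', snd p' + 1, - snd p'}"
      "snd c \<in> {fst p' + 1, - fst p', snd p' + 1, - snd p'}"
      using rosette_coordinates[OF c] by blast
    obtain p where p: "p \<in> ?P" "p' = ?f p" using p'(1) by blast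
    note r = triples_filling_range[OF triples_filling p(1)] bound[OF p(1)]
    have coords: "(- 3 * (n + m) < x \<and> x \<le> 3 * (n + m)) \<and> x \<notin> {- (3 * n)<..3 * n}"
      if "x \<in> {fst p' + 1, - fst p', snd p' + 1, - snd p'}" for x
      using that r assms(5) unfolding p(2) by auto
    have "\<bar>diagonal p'\<bar> = \<bar>diagonal p\<bar>" "\<bar>antidiagonal p' + 1\<bar> = antidiagonal p + 6 * n + 1" using r assms(5) unfolding p(2) by simp_all
    then show ?thesis
      using coords[OF p'(3)] coords[OF p'(4)] p'(2) r assms(3,4) \<open>g < 6 * n\<close> unfolding mem_window by linarith
  qed
  have "rook_paired (Q \<union> ?K)" "card (Q \<union> ?K) = card Q + card ?K"
    by (rule rook_paired_surround[OF rook_paired win Q(2) rook_paired_rosette(1)[OF graceful]]; use K in blast)+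
  moreover have "int (card ?K) = 8 * m"
  proof -
    have "card (?f ` ?P) = card ?P" by (rule card_image) (auto simp: inj_on_def)
    then show ?thesis using rook_paired_rosette(2)[OF graceful] card_pairs_of[OF triples_filling] by simp
  qed
  moreover have "0 \<le> m" using triples_filling unfolding triples_filling_def by linarith
  then have "Q \<subseteq> window (- 3 * (n + m)) (3 * (n + m))"
    using win unfolding subset_iff mem_window by fastforce
  ultimately have "fills (- 3 * (n + m)) (3 * (n + m)) (Q \<union> ?K)"
    using card K unfolding fills_def by (simp add: subset_iff)
  moreover have "g' \<le> \<bar>diagonal c\<bar> \<and> g' \<le> \<bar>antidiagonal c - 1\<bar>" if "c \<in> Q \<union> ?K" for c
    using that Q(2)[of c] K[of c] assms(4) by fastforce
  ultimately show ?thesis unfolding gapped_def by blast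
qed

section \<open>Boards without queens on the main diagonal\<close>

text \<open>The bound is two because the filter retains the queen itself besides its companion.\<close>
definition rook_paired_list :: "cell list \<Rightarrow> bool" where
  "rook_paired_list L \<longleftrightarrow> distinct (map diagonal L) \<and> distinct (map antidiagonal L) \<and>
     list_all (\<lambda>p. length (filter (\<lambda>q. fst q = fst p \<or> snd q = snd p) L) \<le> 2) L"

lemma rook_paired_of_list:
  assumes "rook_paired_list L"
  shows "rook_paired (set L)" and "card (set L) = length L"
proof -
  have d: "distinct (map diagonal L)" "distinct (map antidiagonal L)"
    and two: "\<And>p. p \<in> set L \<Longrightarrow> length (filter (\<lambda>q. fst q = fst p \<or> snd q = snd p) L) \<le> 2"
    using assms unfolding rook_paired_list_def list_all_iff by blast+
  show "card (set L) = length L" using d(1) distinct_map distinct_card by blast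
  have "q = s" if h: "p \<in> set L" "q \<in> set L" "s \<in> set L" "q \<noteq> p" "s \<noteq> p"
    "fst p = fst q \<or> snd p = snd q" "fst p = fst s \<or> snd p = snd s" for p q s
  proof (rule ccontr)
    assume "q \<noteq> s"
    then have "card {p, q, s} = 3" using h(4,5) by auto
    moreover have "{p, q, s} \<subseteq> set (filter (\<lambda>q. fst q = fst p \<or> snd q = snd p) L)" using h by auto
    then have "card {p, q, s} \<le> card (set (filter (\<lambda>q. fst q = fst p \<or> snd q = snd p) L))"
      by (intro card_mono) simp_all
    ultimately show False using two[OF h(1)] card_length[of "filter (\<lambda>q. fst q = fst p \<or> snd q = snd p) L"] by linarith
  qed
  then show "rook_paired (set L)" using d unfolding rook_paired_def distinct_map by blast
qed

lemma admissible_of_list: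
  assumes "rook_paired_list L" "list_all (\<lambda>(r, c). 1 \<le> r \<and> r \<le> int n \<and> 1 \<le> c \<and> c \<le> int n) L"
  shows "\<exists>Q. admissible n Q \<and> card Q = length L"
proof -
  have "set L \<subseteq> window 0 (0 + int n)" using assms(2) by (auto simp: list_all_iff mem_window)
  from admissible_of_window[OF paired_of_rook_paired[OF rook_paired_of_list(1)[OF assms(1)]] this]
  show ?thesis using rook_paired_of_list(2)[OF assms(1)] by simp
qed

text \<open>The main diagonal is kept free for corner queens.\<close>
definition fillable :: "int \<Rightarrow> bool" where
  "fillable n \<longleftrightarrow> (\<exists>a Q. fills a (a + n) Q \<and> (\<forall>p\<in>Q. diagonal p \<noteq> 0))"

text \<open>Half of a board that is symmetric under a half turn determines the other half.\<close>
definition point_symmetric :: "int \<Rightarrow> cell list \<Rightarrow> cell list" where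
  "point_symmetric n L = L @ map (\<lambda>(r, c). (n + 1 - r, n + 1 - c)) L"

definition half_board_ok :: "int \<times> cell list \<Rightarrow> bool" where
  "half_board_ok = (\<lambda>(n, H). let L = point_symmetric n H in
     rook_paired_list L \<and> 3 * int (length L) = 4 * n \<and>
     list_all (\<lambda>(r, c). 1 \<le> r \<and> r \<le> n \<and> 1 \<le> c \<and> c \<le> n \<and> r \<noteq> c) L)"

lemma fillable_of_half:
  assumes "half_board_ok (n, H)"
  shows "fillable n"
proof -
  let ?L = "point_symmetric n H"
  have L: "rook_paired_list ?L" "3 * int (length ?L) = 4 * n"
      "\<And>p. p \<in> set ?L \<Longrightarrow> 1 \<le> fst p \<and> fst p \<le> n \<and> 1 \<le> snd p \<and> snd p \<le> n \<and> fst p \<noteq> snd p"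
    using assms by (auto simp: half_board_ok_def Let_def list_all_iff)
  have "set ?L \<subseteq> window 0 (0 + n)" using L(3) unfolding subset_iff mem_window by force
  then have "fills 0 (0 + n) (set ?L)"
    using rook_paired_of_list[OF L(1)] L(2) unfolding fills_def by simp
  then show ?thesis using L(3) unfolding fillable_def by (metis right_minus_eq)
qed

lemma fillable_of_gapped:
  assumes "gapped m g" "1 \<le> g"
  shows "fillable (6 * m)"
proof -
  obtain Q where Q: "fills (- 3 * m) (3 * m) Q" "\<And>q. q \<in> Q \<Longrightarrow> g \<le> \<bar>diagonal q\<bar>"
    using assms(1) unfolding gapped_def by blast
  have "fills (- 3 * m) (- 3 * m + 6 * m) Q" using Q(1) by simp
  moreover have "diagonal q \<noteq> 0" if "q \<in> Q" for q using Q(2)[OF that] assms(2) by linarith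
  ultimately show ?thesis unfolding fillable_def by blast
qed

text \<open>
  Twelve queens in nine rows and nine columns, four of them before and five of them behind a central square of
  side \<open>2 h\<close>. Up to the position of the square the arrangement is fixed; of the central lines it
  meets only those at distance at most three.
\<close>
definition ring9 :: "int \<Rightarrow> cell list" where
  "ring9 h = [(- h - 3, h + 2), (- h - 3, h + 4), (- h - 2, - h), (- h - 1, h + 1), (- h, - h - 3), (h + 1, - h - 3),
     (h + 2, - h), (h + 3, h + 1), (h + 4, h + 3), (h + 4, h + 5), (h + 5, - h - 2), (h + 5, - h - 1)]"

text \<open>
  This is the step from even to odd multiples of three. It needs the gap 4, the reason for maintaining that
  gap throughout.
\<close>
lemma fillable_ring9:
  assumes "gapped m 4" "8 \<le> m"
  shows "fillable (6 * m + 9)"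
proof -
  obtain Q where Q: "fills (- 3 * m) (3 * m) Q" "\<And>q. q \<in> Q \<Longrightarrow> 4 \<le> \<bar>diagonal q\<bar> \<and> 4 \<le> \<bar>antidiagonal q - 1\<bar>"
    using assms(1) unfolding gapped_def by blast
  define h where "h = 3 * m"
  have h: "24 \<le> h" using assms(2) by (simp add: h_def)
  have rook_paired: "rook_paired Q" and win: "Q \<subseteq> window (- h) h" and card: "3 * int (card Q) = 8 * h"
    using Q(1) unfolding fills_def h_def by simp_all
  let ?K = "ring9 h"
  have K: "rook_paired_list ?K" "length ?K = 12"
    unfolding ring9_def rook_paired_list_def using h by simp_all
  have K2: "(fst p \<notin> {- h<..h} \<and> snd p \<notin> {- h<..h} \<and>
      (\<bar>diagonal p\<bar> < 4 \<or> 2 * h \<le> \<bar>diagonal p\<bar>) \<and> (\<bar>antidiagonal p - 1\<bar> < 4 \<or> 2 * h \<le> \<bar>antidiagonal p - 1\<bar>)) \<and>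
      diagonal p \<noteq> 0 \<and> p \<in> window (- h - 4) (h + 5)" if "p \<in> set ?K" for p
    using that h unfolding ring9_def by (auto simp: mem_window)
  have union: "rook_paired (Q \<union> set ?K)" "card (Q \<union> set ?K) = card Q + 12"
    using rook_paired_surround[OF rook_paired win Q(2) rook_paired_of_list(1)[OF K(1)]] K2 rook_paired_of_list(2)[OF K(1)] K(2) by simp_all
  have "Q \<subseteq> window (- h - 4) (h + 5)" using win unfolding subset_iff mem_window by fastforce
  then have "fills (- h - 4) (- h - 4 + (6 * m + 9)) (Q \<union> set ?K)"
    using union card K2 unfolding fills_def by (auto simp: h_def)
  moreover have "diagonal p \<noteq> 0" if "p \<in> Q \<union> set ?K" for p
    using that Q(2)[of p] K2[of p] by auto
  ultimately show ?thesis unfolding fillable_def by blast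
qed

lemma fillable_sizes:
  assumes "fillable (3 * k)" "0 \<le> k" "i \<le> 2" "int n = 3 * k + int i"
  shows "\<exists>Q. admissible n Q \<and> int (card Q) = 4 * k + int i"
proof -
  obtain a Q where Q: "fills a (a + 3 * k) Q" "\<And>p. p \<in> Q \<Longrightarrow> diagonal p \<noteq> 0"
    using assms(1) unfolding fillable_def by blast
  have card: "int (card Q) = 4 * k" using Q(1) unfolding fills_def by simp
  have "nat (a + 3 * k - a) = n - i" using assms(4) by simp
  note c = admissible_with_corners[OF Q(1) _ Q(2) this[symmetric]]
  have "i = 0 \<or> i = 1 \<or> i = 2" using assms(3) by linarith
  then have "\<exists>Q'. admissible (n - i + i) Q' \<and> card Q' = card Q + i"
    using c assms(2) by auto
  then show ?thesis using assms(2,4) card by force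
qed

section \<open>All sizes from finitely many triples\<close>

lemma coprime_of_mod_6:
  fixes p :: int
  assumes "p mod 6 = 1 \<or> p mod 6 = 5"
  shows "coprime 2 p" "coprime 3 p"
proof -
  have main: "coprime k p" if k: "k dvd 6" for k
  proof (rule coprimeI)
    fix c assume "c dvd k" "c dvd p"
    then have c: "c dvd 6 * (p div 6)" "c dvd p" "c dvd 6" using k dvd_trans dvd_mult2 by blast+
    have "p - 6 * (p div 6) = 1 \<or> 6 * (p div 6) + 6 - p = 1" using assms by presburger
    then show "is_unit c"
      using dvd_diff[OF c(2,1)] dvd_diff[OF dvd_add[OF c(1,3)] c(2)] by metis
  qed
  show "coprime 2 p" "coprime 3 p" using main[of 2] main[of 3] by simp_all
qed

text \<open>
  Board size \<open>6 n\<close> is obtained from a base of size \<open>6 d\<close> with gap \<open>g\<close> by a blow-up with factor \<open>p\<close> and a frame for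
  \<open>m\<close> triples that uses central lines up to distance \<open>u\<close>; the inequality says that the frame fits into
  the gap \<open>p (g - 1) + 1\<close>.
\<close>
definition reached :: "(int \<times> int) list \<Rightarrow> (int \<times> int) list \<Rightarrow> int \<Rightarrow> bool" where
  "reached B F n \<longleftrightarrow> list_ex (\<lambda>(d, g). list_ex (\<lambda>(m, u). (n - m) mod d = 0 \<and>
     (let p = (n - m) div d in 0 < p \<and> (p mod 6 = 1 \<or> p mod 6 = 5) \<and> u \<le> p * (g - 1))) F) B"

text \<open>
  If \<open>n = d p + m\<close> is reached with \<open>d\<close> dividing 8, then so is \<open>n + 48 t\<close>: the factor becomes
  \<open>p + 6 (8/d) t\<close>, which has the same residue modulo 6 and leaves an even larger gap.
\<close>
lemma gapped_of_reached:
  assumes "reached B F n"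
    and B: "\<And>d g. (d, g) \<in> set B \<Longrightarrow> gapped d g \<and> 0 < d \<and> 1 \<le> g"
    and F: "\<And>m u. (m, u) \<in> set F \<Longrightarrow> 3 \<le> u \<and> (\<exists>zs. frame_triples (m, 4, u, zs))"
    and t: "0 \<le> t" "t = 0 \<or> (\<forall>(d, g)\<in>set B. d dvd 8)"
  shows "gapped (n + 48 * t) 4"
proof -
  obtain d g m u where dg: "(d, g) \<in> set B" and mu: "(m, u) \<in> set F" and mod: "(n - m) mod d = 0"
    and p: "0 < (n - m) div d" "(n - m) div d mod 6 = 1 \<or> (n - m) div d mod 6 = 5"
      "u \<le> (n - m) div d * (g - 1)"
    using assms(1) by (auto simp: reached_def list_ex_iff Let_def)
  note B = B[OF dg] and F = F[OF mu]
  obtain zs where zs: "frame_triples (m, 4, u, zs)" using F by blast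
  define p0 where "p0 = (n - m) div d"
  have n: "n = d * p0 + m" using mod mult_div_mod_eq[of d "n - m"] by (simp add: p0_def)
  have "t = 0 \<or> d dvd 8" using t(2) dg by blast
  then obtain e where e: "8 * t = d * e" "0 \<le> e"
  proof
    assume "t = 0" then show ?thesis using that[of 0] by simp
  next
    assume "d dvd 8"
    then obtain c where c: "8 = d * c" by (rule dvdE)
    then have "0 \<le> c" using B by (smt (verit) zero_less_mult_iff)
    then show ?thesis using that[of "c * t"] c t(1) by simp
  qed
  define p where "p = p0 + 6 * e"
  have p_pos: "0 < p" and p_mod: "p mod 6 = 1 \<or> p mod 6 = 5"
    using p(1,2) e(2) unfolding p_def p0_def[symmetric] by simp_all
  have "p0 * (g - 1) \<le> p * (g - 1)"
    using B e(2) by (intro mult_right_mono) (simp_all add: p_def)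
  then have u: "u < p * (g - 1) + 1" using p(3) by (simp add: p0_def)
  have blown: "gapped (p * d) (p * (g - 1) + 1)"
    using gapped_blow_up[of d g p] B p_pos coprime_of_mod_6[OF p_mod] by blast
  have "gapped (p * d + m) 4"
    by (rule gapped_frame[OF blown zs u]) (use u F B p_pos in simp_all)
  moreover have "p * d + m = n + 48 * t"
    using n e(1) unfolding p_def by (simp add: algebra_simps)
  ultimately show ?thesis by simp
qed

text \<open>
  Each entry consists of \<open>m\<close>, a gap and a partition of \<open>0, \<dots>, 3 m - 1\<close> into triples. The partitions
  come from a computer search and show no pattern. Those with \<open>m < 8\<close> have a gap
  below 4; they serve for small sizes and for blow-ups. There is no suitable partition for \<open>m = 2\<close>.
\<close>
definition bases :: "(int \<times> int \<times> int list) list" where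
  "bases = [
    (1, 1, [2, 0, 1]),
    (3, 1, [4, 1, 8, 5, 3, 6, 7, 0, 2]),
    (4, 2, [7, 3, 10, 8, 0, 6, 9, 2, 4, 11, 1, 5]),
    (5, 2, [10, 1, 6, 11, 3, 9, 12, 5, 7, 13, 0, 2, 14, 4, 8]),
    (6, 2, [1, 8, 14, 11, 2, 3, 12, 6, 7, 13, 9, 10, 16, 4, 5, 17, 0, 15]),
    (7, 3, [5, 12, 15, 8, 0, 14, 13, 10, 17, 16, 2, 11, 18, 1, 3, 19, 6, 7, 20, 4, 9]),
    (8, 4, [4, 10, 16, 17, 1, 13, 18, 7, 9, 19, 12, 14, 20, 3, 6, 21, 8, 11, 22, 0, 2, 23, 5, 15]),
    (9, 4, [17, 0, 10, 18, 4, 7, 19, 11, 13, 20, 16, 25, 21, 2, 8, 22, 6, 12, 23, 1, 3, 24, 9, 15, 26,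
      5, 14]),
    (10, 4, [3, 11, 27, 19, 6, 12, 20, 16, 25, 21, 0, 7, 22, 2, 10, 23, 4, 17, 24, 14, 15, 26, 8, 9, 28,
      1, 5, 29, 13, 18]),
    (11, 4, [16, 12, 25, 19, 5, 8, 21, 1, 14, 22, 3, 4, 26, 10, 11, 27, 6, 15, 28, 18, 20, 29, 23, 24,
      30, 13, 17, 31, 7, 9, 32, 0, 2]),
    (12, 5, [18, 24, 26, 19, 0, 5, 22, 10, 15, 27, 3, 11, 28, 17, 23, 29, 6, 12, 30, 9, 20, 31, 2, 16,
      32, 4, 14, 33, 1, 7, 34, 21, 25, 35, 8, 13]),
    (13, 4, [15, 26, 30, 16, 8, 12, 20, 27, 29, 21, 2, 11, 24, 6, 7, 31, 19, 25, 32, 5, 10, 33, 13, 28,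
      34, 4, 18, 35, 0, 9, 36, 22, 23, 37, 3, 14, 38, 1, 17]),
    (14, 4, [4, 0, 28, 12, 18, 24, 17, 32, 38, 19, 33, 35, 20, 2, 30, 27, 14, 16, 29, 10, 22, 31, 3, 9,
      34, 25, 26, 36, 6, 11, 37, 1, 8, 39, 5, 7, 40, 13, 23, 41, 15, 21]),
    (15, 5, [13, 21, 27, 18, 28, 39, 19, 2, 4, 30, 17, 41, 31, 6, 24, 32, 20, 26, 34, 11, 29, 35, 8, 16,
      36, 0, 3, 37, 5, 7, 38, 12, 22, 40, 1, 9, 42, 14, 33, 43, 23, 25, 44, 10, 15]),
    (16, 5, [0, 22, 34, 24, 4, 41, 26, 18, 19, 28, 2, 15, 30, 11, 20, 31, 6, 17, 37, 10, 16, 38, 1, 29,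
      39, 7, 23, 40, 12, 35, 42, 27, 36, 43, 13, 25, 44, 32, 33, 45, 9, 21, 46, 3, 5, 47, 8, 14]),
    (17, 5, [15, 26, 39, 17, 8, 45, 23, 6, 13, 28, 33, 48, 30, 22, 36, 32, 7, 11, 35, 21, 42, 37, 3, 10,
      38, 20, 25, 40, 2, 4, 41, 19, 29, 43, 12, 14, 44, 5, 9, 46, 0, 27, 47, 24, 31, 49, 16, 34,
      50, 1, 18]),
    (18, 5, [5, 24, 33, 20, 3, 38, 27, 7, 13, 29, 14, 40, 30, 22, 25, 34, 41, 43, 36, 11, 46, 37, 31, 49,
      39, 10, 23, 42, 2, 4, 44, 12, 21, 45, 8, 19, 47, 1, 16, 48, 6, 35, 50, 17, 28, 51, 0, 15,
      52, 9, 18, 53, 26, 32]),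
    (19, 6, [28, 5, 13, 30, 18, 48, 37, 6, 12, 38, 9, 22, 39, 29, 31, 40, 4, 23, 41, 11, 34, 42, 14, 20,
      44, 25, 50, 45, 21, 32, 46, 0, 7, 47, 27, 36, 49, 16, 35, 51, 8, 10, 52, 15, 43, 53, 2, 26,
      54, 19, 33, 55, 3, 17, 56, 1, 24]),
    (21, 7, [3, 25, 54, 34, 17, 20, 36, 2, 5, 40, 4, 13, 43, 35, 52, 44, 24, 31, 45, 19, 27, 47, 9, 37,
      48, 7, 33, 49, 38, 42, 50, 15, 26, 51, 23, 28, 53, 16, 32, 55, 8, 22, 56, 6, 10, 57, 14, 41,
      58, 39, 46, 59, 11, 29, 60, 0, 1, 61, 12, 21, 62, 18, 30]),
    (22, 5, [6, 25, 33, 16, 30, 65, 18, 12, 52, 29, 7, 37, 38, 14, 47, 40, 15, 23, 42, 0, 49, 44, 5, 21,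
      46, 10, 28, 48, 32, 53, 50, 22, 63, 51, 36, 41, 54, 34, 43, 55, 3, 20, 56, 26, 27, 57, 11,
      45, 58, 4, 13, 59, 1, 8, 60, 19, 39, 61, 17, 35, 62, 2, 24, 64, 9, 31]),
    (23, 6, [3, 11, 29, 5, 39, 66, 22, 32, 43, 24, 4, 68, 30, 17, 49, 40, 33, 57, 46, 28, 52, 47, 9, 20,
      48, 7, 13, 51, 2, 42, 53, 10, 41, 54, 12, 18, 55, 25, 27, 56, 31, 45, 58, 0, 6, 59, 36, 37,
      60, 21, 44, 61, 1, 8, 62, 15, 38, 63, 23, 26, 64, 14, 50, 65, 19, 34, 67, 16, 35]),
    (24, 7, [4, 22, 28, 14, 42, 53, 23, 30, 49, 33, 1, 12, 43, 34, 35, 46, 9, 56, 48, 10, 60, 51, 6, 40,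
      54, 32, 41, 55, 19, 25, 57, 8, 37, 58, 29, 39, 59, 7, 45, 61, 18, 38, 62, 31, 47, 63, 13,
      21, 64, 11, 17, 65, 3, 24, 66, 26, 50, 67, 2, 16, 68, 5, 20, 69, 44, 52, 70, 15, 36, 71, 0,
      27]),
    (26, 7, [19, 53, 59, 20, 2, 51, 36, 26, 57, 38, 16, 46, 40, 4, 8, 43, 32, 60, 44, 11, 14, 48, 21, 63,
      54, 28, 42, 55, 1, 39, 56, 17, 49, 58, 7, 71, 62, 27, 33, 64, 23, 50, 65, 37, 45, 66, 41,
      47, 67, 0, 9, 68, 15, 18, 69, 5, 22, 70, 10, 61, 72, 29, 34, 73, 12, 25, 74, 3, 30, 75, 6,
      13, 76, 24, 52, 77, 31, 35]),
    (27, 8, [10, 43, 49, 28, 3, 59, 44, 6, 33, 46, 17, 60, 48, 13, 14, 52, 12, 30, 54, 31, 63, 55, 37,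
      65, 56, 9, 20, 58, 38, 39, 61, 34, 53, 62, 5, 47, 64, 40, 77, 66, 24, 50, 67, 11, 22, 68,
      15, 42, 69, 32, 57, 70, 1, 18, 71, 23, 41, 72, 26, 51, 73, 29, 45, 74, 0, 7, 75, 4, 16, 76,
      27, 35, 78, 2, 8, 79, 21, 36, 80, 19, 25]),
    (29, 7, [0, 27, 60, 2, 14, 49, 8, 26, 71, 24, 64, 67, 32, 17, 39, 36, 47, 66, 52, 38, 84, 55, 6, 46,
      57, 19, 21, 61, 28, 37, 62, 3, 18, 63, 41, 42, 68, 48, 58, 69, 1, 15, 70, 22, 45, 72, 56,
      59, 73, 50, 65, 74, 7, 35, 75, 11, 20, 76, 31, 34, 77, 40, 43, 78, 4, 9, 79, 33, 53, 80, 5,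
      23, 81, 16, 30, 82, 12, 51, 83, 25, 54, 85, 29, 44, 86, 10, 13]),
    (31, 8, [5, 58, 82, 12, 32, 45, 16, 40, 67, 25, 3, 14, 35, 65, 73, 38, 23, 47, 62, 2, 54, 63, 31, 46,
      66, 11, 18, 68, 43, 50, 69, 19, 33, 70, 0, 56, 71, 10, 61, 74, 27, 30, 75, 44, 59, 76, 41,
      49, 77, 51, 64, 78, 4, 55, 79, 20, 60, 80, 26, 34, 81, 15, 39, 83, 7, 8, 84, 28, 72, 85, 42,
      57, 86, 37, 52, 87, 6, 48, 88, 1, 36, 89, 9, 21, 90, 17, 53, 91, 22, 24, 92, 13, 29]),
    (32, 8, [7, 18, 61, 23, 47, 48, 34, 13, 26, 45, 63, 67, 56, 21, 36, 59, 43, 90, 60, 3, 79, 62, 4, 17,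
      64, 54, 78, 65, 31, 33, 66, 19, 27, 68, 77, 83, 69, 6, 14, 71, 15, 44, 72, 10, 28, 73, 22,
      40, 75, 5, 58, 76, 2, 53, 80, 39, 51, 81, 8, 29, 82, 46, 70, 84, 25, 38, 85, 35, 42, 86, 20,
      37, 87, 57, 74, 88, 0, 50, 89, 12, 52, 91, 16, 49, 92, 24, 32, 93, 1, 11, 94, 9, 41, 95, 30,
      55]),
    (33, 7, [17, 32, 44, 18, 35, 97, 24, 71, 87, 30, 50, 74, 34, 1, 21, 36, 22, 57, 54, 31, 43, 63, 8,
      26, 64, 3, 4, 65, 49, 53, 66, 28, 75, 67, 15, 33, 68, 39, 61, 76, 12, 25, 77, 2, 29, 78, 20,
      56, 79, 40, 51, 80, 7, 48, 81, 5, 62, 83, 16, 73, 84, 6, 42, 85, 11, 59, 86, 37, 46, 88, 58,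
      70, 89, 19, 23, 90, 13, 82, 91, 45, 60, 92, 0, 47, 93, 9, 52, 94, 41, 69, 95, 10, 38, 96,
      14, 72, 98, 27, 55]),
    (34, 9, [0, 16, 38, 3, 57, 67, 31, 12, 66, 53, 65, 99, 54, 22, 34, 60, 20, 88, 63, 49, 50, 71, 28,
      37, 72, 7, 43, 73, 14, 36, 74, 26, 47, 75, 15, 18, 76, 2, 40, 77, 46, 62, 78, 29, 69, 81,
      55, 56, 82, 52, 61, 83, 13, 27, 84, 1, 8, 85, 10, 17, 86, 41, 68, 87, 24, 64, 89, 42, 79,
      90, 35, 39, 91, 58, 80, 92, 25, 70, 93, 21, 51, 94, 4, 9, 95, 11, 33, 96, 23, 30, 97, 44,
      45, 98, 6, 48, 100, 5, 59, 101, 19, 32]),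
    (36, 7, [15, 58, 60, 16, 1, 30, 20, 70, 83, 34, 4, 59, 40, 31, 66, 42, 19, 23, 51, 62, 79, 56, 10,
      104, 61, 54, 85, 64, 74, 97, 67, 38, 47, 69, 28, 105, 73, 9, 22, 75, 37, 53, 77, 43, 93, 78,
      29, 86, 80, 5, 68, 81, 27, 98, 82, 12, 17, 84, 0, 63, 87, 45, 55, 88, 8, 48, 89, 52, 76, 90,
      2, 35, 91, 13, 32, 92, 24, 65, 94, 7, 25, 95, 3, 39, 96, 6, 14, 99, 18, 41, 100, 11, 21,
      101, 44, 57, 102, 49, 50, 103, 26, 72, 106, 33, 71, 107, 36, 46]),
    (37, 8, [6, 19, 49, 11, 36, 110, 31, 48, 81, 34, 69, 96, 42, 66, 93, 52, 80, 99, 57, 8, 28, 58, 18,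
      70, 60, 15, 83, 62, 5, 54, 63, 30, 33, 71, 13, 56, 72, 1, 86, 76, 4, 24, 77, 38, 61, 78, 9,
      98, 79, 20, 41, 82, 51, 64, 84, 29, 40, 85, 10, 74, 87, 27, 53, 88, 23, 35, 89, 67, 68, 91,
      45, 50, 92, 55, 73, 94, 3, 12, 97, 7, 65, 100, 22, 90, 101, 47, 59, 102, 0, 75, 103, 14, 16,
      104, 21, 95, 105, 26, 32, 106, 39, 43, 107, 37, 46, 108, 2, 44, 109, 17, 25]),
    (38, 8, [8, 83, 109, 17, 28, 81, 34, 13, 16, 36, 44, 70, 43, 18, 73, 46, 84, 96, 50, 77, 95, 53, 4,
      37, 58, 26, 29, 64, 40, 111, 65, 0, 78, 74, 39, 55, 75, 1, 60, 76, 35, 56, 80, 19, 71, 82,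
      11, 12, 85, 3, 62, 86, 10, 72, 89, 47, 61, 91, 23, 24, 92, 32, 48, 93, 41, 67, 94, 25, 31,
      97, 57, 66, 98, 59, 88, 99, 42, 63, 100, 20, 21, 101, 45, 79, 102, 69, 90, 103, 7, 49, 104,
      51, 87, 105, 2, 68, 106, 22, 33, 107, 5, 52, 108, 15, 30, 110, 27, 38, 112, 6, 14, 113, 9,
      54]),
    (39, 8, [20, 31, 61, 24, 42, 94, 25, 57, 67, 28, 82, 100, 32, 91, 98, 34, 10, 55, 47, 1, 86, 49, 14,
      83, 52, 26, 43, 56, 40, 84, 62, 35, 77, 66, 4, 53, 69, 19, 81, 71, 2, 90, 72, 7, 39, 78, 30,
      68, 79, 11, 87, 80, 27, 63, 89, 45, 58, 93, 8, 36, 95, 17, 59, 96, 41, 116, 97, 3, 16, 99,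
      23, 74, 101, 13, 64, 102, 15, 51, 103, 65, 73, 104, 5, 44, 105, 21, 76, 106, 0, 92, 107, 60,
      85, 108, 33, 50, 109, 46, 48, 110, 6, 54, 111, 38, 88, 112, 9, 12, 113, 18, 70, 114, 22, 37,
      115, 29, 75]),
    (41, 9, [15, 84, 100, 16, 42, 106, 38, 85, 104, 41, 6, 99, 43, 57, 81, 45, 26, 98, 58, 75, 79, 59,
      90, 115, 61, 20, 83, 67, 24, 47, 69, 25, 37, 72, 39, 82, 74, 0, 4, 77, 27, 28, 86, 31, 34,
      87, 9, 11, 88, 51, 60, 89, 8, 73, 92, 65, 80, 93, 48, 63, 94, 1, 76, 95, 33, 66, 96, 35, 50,
      97, 13, 29, 101, 110, 114, 102, 62, 91, 103, 49, 78, 105, 22, 54, 107, 68, 71, 108, 5, 17,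
      109, 21, 36, 111, 7, 44, 112, 23, 70, 113, 19, 53, 116, 3, 52, 117, 30, 46, 118, 32, 55,
      119, 2, 10, 120, 18, 40, 121, 56, 64, 122, 12, 14]),
    (43, 11, [7, 43, 92, 33, 4, 99, 40, 52, 94, 42, 77, 84, 65, 6, 21, 69, 45, 55, 74, 11, 17, 79, 62, 63,
      82, 22, 27, 83, 37, 104, 85, 9, 60, 86, 12, 16, 88, 58, 110, 91, 24, 46, 93, 18, 50, 96, 76,
      78, 98, 51, 71, 100, 31, 115, 101, 28, 67, 102, 19, 20, 103, 2, 90, 105, 25, 66, 106, 53,
      95, 107, 5, 57, 108, 47, 75, 109, 1, 72, 111, 14, 80, 112, 41, 64, 113, 73, 87, 114, 36, 49,
      116, 54, 97, 117, 61, 89, 118, 29, 34, 119, 38, 70, 120, 3, 13, 121, 23, 30, 122, 26, 81,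
      123, 44, 59, 124, 15, 56, 125, 35, 48, 126, 32, 68, 127, 8, 39, 128, 0, 10]),
    (46, 10, [7, 39, 93, 12, 89, 103, 15, 1, 26, 22, 104, 122, 44, 14, 24, 47, 70, 98, 59, 115, 119, 66,
      25, 45, 67, 85, 105, 71, 32, 99, 73, 40, 63, 77, 31, 53, 81, 56, 125, 86, 23, 101, 87, 9,
      52, 88, 43, 72, 92, 3, 30, 94, 0, 116, 96, 62, 83, 100, 20, 27, 106, 34, 80, 107, 17, 78,
      108, 51, 54, 109, 41, 42, 110, 57, 79, 111, 5, 18, 113, 10, 55, 114, 35, 95, 117, 4, 29,
      118, 37, 82, 120, 46, 68, 121, 13, 36, 123, 48, 75, 124, 58, 112, 126, 21, 76, 127, 8, 16,
      128, 64, 91, 129, 74, 102, 130, 65, 69, 131, 11, 33, 132, 49, 61, 133, 84, 90, 134, 19, 50,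
      135, 6, 28, 136, 2, 60, 137, 38, 97]),
    (47, 10, [10, 84, 91, 26, 36, 122, 29, 3, 74, 37, 79, 120, 41, 55, 94, 53, 19, 92, 64, 27, 108, 70,
      16, 105, 75, 86, 126, 77, 25, 136, 78, 21, 58, 80, 93, 111, 81, 34, 59, 85, 44, 103, 88, 0,
      40, 89, 43, 65, 90, 35, 60, 95, 18, 72, 97, 30, 109, 99, 1, 50, 100, 71, 116, 102, 31, 66,
      104, 5, 22, 107, 39, 51, 110, 52, 83, 112, 32, 48, 113, 8, 63, 114, 45, 82, 117, 2, 98, 118,
      33, 46, 119, 76, 140, 121, 56, 96, 123, 11, 106, 124, 13, 62, 125, 6, 87, 127, 20, 67, 128,
      15, 42, 129, 23, 101, 130, 12, 115, 131, 7, 38, 132, 9, 24, 133, 49, 54, 134, 68, 73, 135,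
      4, 57, 137, 28, 61, 138, 17, 47, 139, 14, 69]),
    (48, 8, [10, 60, 71, 14, 125, 126, 17, 37, 55, 19, 97, 119, 21, 80, 100, 39, 4, 47, 49, 3, 79, 58,
      31, 91, 66, 40, 122, 67, 38, 88, 69, 85, 105, 72, 94, 111, 76, 24, 57, 77, 8, 59, 83, 20,
      68, 84, 33, 118, 90, 1, 81, 95, 29, 143, 96, 56, 82, 102, 27, 89, 104, 9, 16, 106, 26, 44,
      109, 35, 78, 110, 5, 63, 113, 28, 46, 114, 11, 50, 115, 74, 103, 117, 52, 93, 120, 23, 48,
      121, 6, 61, 123, 42, 53, 124, 92, 107, 127, 36, 116, 128, 70, 86, 129, 75, 101, 130, 32, 73,
      131, 22, 108, 132, 13, 64, 133, 25, 34, 134, 41, 51, 135, 0, 98, 136, 12, 87, 137, 43, 112,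
      138, 18, 54, 139, 7, 62, 140, 2, 30, 141, 45, 65, 142, 15, 99]),
    (51, 11, [15, 125, 140, 27, 57, 75, 28, 62, 139, 29, 3, 60, 36, 76, 113, 42, 96, 101, 44, 6, 69, 53,
      95, 129, 56, 0, 122, 68, 91, 107, 83, 100, 111, 84, 23, 35, 85, 14, 49, 92, 4, 39, 98, 82,
      87, 99, 31, 80, 104, 32, 67, 105, 12, 117, 106, 19, 48, 108, 33, 94, 109, 2, 88, 114, 79,
      127, 115, 50, 74, 116, 17, 52, 118, 58, 89, 119, 13, 18, 120, 38, 93, 121, 5, 25, 123, 73,
      77, 124, 46, 81, 126, 37, 40, 128, 34, 45, 131, 22, 61, 132, 63, 112, 133, 66, 71, 135, 16,
      51, 136, 21, 55, 137, 8, 64, 138, 43, 86, 141, 11, 78, 142, 97, 110, 143, 7, 41, 144, 20,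
      65, 145, 24, 90, 146, 1, 72, 147, 30, 103, 148, 26, 130, 149, 102, 134, 150, 10, 70, 151,
      47, 59, 152, 9, 54]),
    (53, 15, [0, 21, 41, 7, 56, 127, 15, 74, 85, 32, 98, 110, 34, 99, 116, 61, 77, 121, 62, 6, 149, 66,
      97, 118, 70, 133, 142, 75, 28, 114, 87, 19, 37, 88, 65, 107, 89, 59, 113, 91, 46, 76, 93,
      16, 146, 95, 12, 123, 101, 27, 57, 102, 69, 139, 106, 80, 124, 111, 63, 94, 115, 26, 36,
      117, 8, 92, 119, 64, 81, 120, 2, 86, 122, 22, 82, 125, 54, 96, 126, 13, 31, 128, 47, 52,
      129, 17, 72, 130, 55, 103, 131, 35, 45, 132, 4, 112, 134, 43, 73, 135, 84, 100, 136, 9, 25,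
      137, 23, 83, 138, 5, 53, 140, 38, 48, 141, 24, 109, 143, 11, 49, 144, 29, 108, 145, 42, 78,
      147, 67, 104, 148, 50, 51, 150, 20, 44, 151, 30, 105, 152, 79, 90, 153, 3, 60, 154, 1, 18,
      155, 14, 71, 156, 40, 68, 157, 33, 58, 158, 10, 39]),
    (54, 11, [2, 30, 125, 5, 23, 67, 14, 120, 152, 27, 84, 144, 29, 41, 115, 47, 100, 131, 57, 3, 103, 61,
      37, 104, 69, 19, 127, 72, 87, 92, 74, 43, 137, 80, 58, 135, 86, 118, 123, 88, 102, 128, 89,
      15, 106, 90, 71, 77, 91, 22, 44, 93, 48, 114, 97, 21, 55, 99, 50, 134, 101, 0, 75, 107, 56,
      63, 111, 8, 70, 112, 60, 148, 113, 17, 20, 119, 81, 108, 121, 11, 24, 122, 35, 40, 124, 32,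
      59, 126, 13, 28, 129, 7, 62, 130, 1, 45, 132, 53, 98, 133, 9, 18, 136, 66, 109, 140, 33, 46,
      141, 64, 116, 142, 16, 83, 143, 34, 65, 145, 54, 79, 146, 42, 51, 147, 6, 117, 149, 49, 110,
      150, 39, 82, 151, 4, 95, 153, 26, 105, 154, 38, 94, 155, 25, 139, 156, 12, 31, 157, 36, 85,
      158, 68, 78, 159, 10, 76, 160, 52, 96, 161, 73, 138]),
    (57, 10, [1, 145, 146, 6, 78, 113, 7, 116, 132, 29, 40, 56, 38, 2, 84, 42, 32, 119, 51, 103, 149, 52,
      9, 37, 54, 82, 102, 57, 8, 118, 59, 34, 138, 63, 44, 92, 66, 87, 124, 74, 43, 137, 93, 10,
      58, 100, 41, 76, 106, 14, 72, 109, 4, 89, 110, 22, 123, 111, 15, 88, 112, 98, 130, 117, 77,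
      129, 121, 70, 83, 122, 23, 46, 125, 95, 142, 127, 47, 153, 128, 0, 91, 133, 27, 79, 134, 45,
      50, 136, 33, 86, 139, 13, 75, 140, 25, 101, 141, 30, 60, 143, 21, 24, 144, 49, 71, 147, 80,
      131, 148, 35, 61, 150, 12, 68, 151, 73, 107, 152, 55, 96, 154, 18, 85, 155, 81, 90, 156, 39,
      65, 157, 97, 115, 158, 19, 105, 159, 114, 126, 160, 28, 48, 161, 26, 104, 162, 69, 94, 163,
      53, 108, 164, 62, 64, 165, 5, 31, 166, 16, 36, 167, 120, 135, 168, 17, 67, 169, 11, 20, 170,
      3, 99]),
    (58, 5, [1, 32, 132, 3, 80, 148, 9, 16, 106, 11, 81, 121, 13, 25, 34, 15, 37, 50, 17, 90, 119, 23,
      98, 149, 38, 157, 170, 40, 65, 76, 43, 20, 130, 68, 52, 113, 69, 42, 151, 79, 123, 138, 82,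
      35, 115, 92, 31, 46, 97, 67, 135, 99, 86, 153, 101, 33, 109, 104, 39, 61, 107, 47, 87, 111,
      71, 122, 112, 14, 84, 114, 100, 105, 118, 28, 128, 124, 44, 75, 125, 22, 110, 126, 54, 131,
      127, 48, 95, 129, 60, 62, 133, 57, 116, 137, 49, 56, 139, 88, 102, 140, 0, 85, 141, 30, 70,
      142, 6, 19, 145, 89, 103, 146, 4, 94, 147, 27, 58, 150, 59, 93, 152, 24, 74, 155, 51, 63,
      156, 2, 73, 158, 5, 45, 159, 29, 96, 160, 136, 154, 161, 18, 120, 162, 143, 144, 163, 7,
      134, 164, 64, 78, 165, 36, 91, 166, 41, 108, 167, 72, 117, 168, 53, 83, 169, 8, 55, 171, 21,
      66, 172, 12, 26, 173, 10, 77]),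
    (59, 10, [3, 79, 98, 7, 78, 141, 8, 31, 149, 17, 46, 67, 19, 53, 60, 50, 70, 167, 51, 95, 143, 54, 39,
      160, 64, 74, 136, 69, 18, 85, 75, 47, 138, 88, 101, 133, 89, 20, 29, 100, 25, 111, 103, 44,
      55, 106, 59, 82, 113, 0, 14, 117, 62, 84, 119, 49, 146, 122, 21, 83, 123, 58, 97, 125, 9,
      108, 126, 65, 73, 128, 4, 142, 129, 87, 94, 130, 30, 63, 132, 48, 151, 134, 37, 116, 135,
      110, 114, 137, 71, 107, 139, 28, 43, 140, 22, 35, 144, 12, 40, 145, 93, 96, 147, 2, 57, 148,
      86, 112, 150, 52, 104, 152, 109, 120, 153, 99, 131, 154, 23, 76, 155, 15, 124, 156, 27, 41,
      157, 68, 169, 158, 5, 90, 159, 77, 121, 161, 34, 105, 162, 11, 81, 163, 33, 56, 164, 42,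
      127, 165, 13, 45, 166, 10, 24, 168, 6, 91, 170, 16, 61, 171, 1, 92, 172, 26, 115, 173, 36,
      80, 174, 38, 66, 175, 32, 72, 176, 102, 118]),
    (61, 13, [23, 113, 114, 35, 7, 50, 42, 60, 112, 43, 90, 127, 45, 13, 78, 47, 108, 110, 53, 22, 88, 62,
      16, 163, 64, 104, 146, 73, 98, 117, 84, 29, 58, 93, 56, 131, 94, 32, 71, 100, 116, 150, 106,
      4, 128, 120, 0, 107, 121, 24, 138, 124, 82, 180, 125, 21, 37, 126, 140, 145, 129, 76, 149,
      130, 17, 49, 132, 27, 80, 134, 18, 86, 135, 9, 66, 136, 109, 165, 137, 57, 173, 139, 75,
      118, 141, 19, 74, 142, 44, 101, 143, 70, 85, 144, 55, 105, 147, 51, 79, 148, 8, 172, 151,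
      52, 68, 152, 20, 122, 153, 87, 99, 154, 46, 48, 155, 38, 81, 156, 41, 91, 157, 28, 123, 158,
      25, 63, 159, 10, 36, 160, 1, 103, 161, 31, 61, 162, 69, 111, 164, 77, 119, 166, 14, 72, 167,
      89, 95, 168, 40, 97, 169, 15, 92, 170, 26, 34, 171, 6, 59, 174, 33, 65, 175, 83, 115, 176,
      2, 12, 177, 67, 102, 178, 11, 39, 179, 3, 54, 181, 30, 96, 182, 5, 133]),
    (72, 15, [0, 66, 148, 2, 36, 189, 18, 104, 124, 29, 6, 174, 31, 69, 127, 60, 145, 190, 62, 27, 149,
      70, 125, 153, 80, 39, 161, 84, 67, 105, 91, 135, 199, 92, 121, 156, 97, 64, 65, 98, 56, 117,
      99, 171, 178, 106, 75, 76, 108, 48, 177, 114, 49, 184, 116, 23, 205, 122, 1, 51, 123, 4,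
      138, 128, 81, 144, 129, 154, 166, 133, 34, 71, 140, 5, 113, 142, 118, 120, 147, 22, 74, 150,
      82, 168, 151, 13, 94, 152, 47, 132, 158, 14, 198, 159, 33, 110, 160, 46, 78, 163, 59, 83,
      164, 10, 37, 165, 15, 68, 167, 45, 57, 170, 38, 196, 172, 30, 35, 173, 12, 61, 175, 44, 72,
      176, 7, 63, 179, 101, 126, 180, 20, 88, 181, 90, 93, 182, 53, 130, 183, 42, 109, 185, 8,
      157, 186, 28, 136, 187, 11, 112, 188, 9, 54, 191, 52, 137, 192, 26, 115, 193, 86, 95, 194,
      79, 100, 195, 119, 139, 197, 134, 146, 200, 141, 155, 201, 85, 143, 202, 55, 107, 203, 25,
      103, 204, 16, 87, 206, 21, 50, 207, 89, 96, 208, 41, 162, 209, 58, 73, 210, 19, 77, 211, 40,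
      102, 212, 32, 169, 213, 24, 111, 214, 3, 17, 215, 43, 131]),
    (73, 16, [15, 135, 148, 25, 42, 178, 32, 141, 214, 45, 88, 167, 47, 63, 151, 51, 138, 203, 70, 106,
      114, 76, 52, 166, 78, 9, 13, 84, 8, 180, 87, 185, 190, 89, 58, 59, 90, 115, 119, 98, 61,
      147, 100, 27, 44, 101, 10, 81, 108, 82, 186, 112, 49, 171, 118, 96, 145, 124, 22, 158, 126,
      16, 91, 127, 38, 72, 129, 5, 157, 137, 19, 216, 139, 65, 179, 143, 73, 95, 152, 12, 175,
      153, 53, 86, 155, 41, 103, 160, 34, 102, 162, 24, 68, 163, 80, 144, 164, 123, 132, 165, 28,
      105, 168, 121, 218, 169, 39, 50, 170, 104, 128, 172, 55, 134, 173, 120, 140, 174, 6, 97,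
      176, 3, 21, 177, 1, 159, 181, 74, 130, 182, 46, 161, 183, 37, 77, 184, 69, 83, 187, 26, 142,
      188, 4, 113, 189, 62, 150, 191, 20, 66, 192, 33, 110, 193, 43, 85, 194, 71, 109, 195, 131,
      149, 196, 99, 125, 197, 111, 136, 198, 93, 117, 199, 30, 60, 200, 56, 79, 201, 0, 31, 202,
      107, 122, 204, 29, 48, 205, 64, 92, 206, 18, 75, 207, 11, 40, 208, 36, 146, 209, 17, 67,
      210, 94, 156, 211, 57, 154, 212, 23, 54, 213, 2, 35, 215, 7, 116, 217, 14, 133]),
    (79, 17, [2, 76, 118, 9, 28, 149, 11, 206, 215, 50, 17, 72, 53, 107, 111, 66, 173, 220, 67, 114, 145,
      69, 140, 188, 86, 23, 60, 94, 13, 155, 97, 122, 203, 112, 80, 141, 125, 27, 164, 128, 146,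
      187, 129, 57, 184, 133, 41, 85, 134, 43, 51, 139, 8, 169, 143, 1, 120, 144, 31, 91, 148,
      103, 121, 151, 42, 224, 153, 18, 194, 161, 71, 73, 163, 45, 180, 165, 39, 130, 166, 10, 65,
      167, 16, 87, 168, 19, 22, 172, 12, 58, 174, 81, 131, 175, 108, 109, 177, 95, 100, 178, 44,
      63, 179, 117, 216, 181, 40, 79, 182, 106, 138, 183, 33, 83, 185, 74, 209, 186, 90, 158, 189,
      105, 137, 190, 21, 54, 191, 47, 126, 192, 135, 156, 193, 30, 142, 195, 15, 52, 196, 4, 68,
      197, 64, 102, 198, 99, 104, 199, 37, 110, 200, 150, 154, 201, 5, 152, 202, 132, 160, 204,
      77, 170, 205, 119, 226, 207, 7, 176, 208, 34, 70, 210, 88, 113, 211, 14, 171, 212, 75, 92,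
      213, 32, 49, 214, 59, 89, 217, 3, 93, 218, 61, 115, 219, 29, 48, 221, 136, 157, 222, 147,
      162, 223, 20, 84, 225, 55, 96, 227, 25, 38, 228, 123, 159, 229, 0, 46, 230, 62, 98, 231,
      101, 127, 232, 24, 26, 233, 35, 116, 234, 6, 82, 235, 36, 56, 236, 78, 124]),
    (89, 19, [7, 53, 109, 8, 105, 198, 15, 156, 220, 32, 127, 163, 35, 63, 202, 38, 69, 224, 48, 24, 107,
      50, 125, 193, 85, 17, 185, 104, 39, 74, 124, 44, 212, 140, 80, 106, 144, 52, 184, 145, 78,
      264, 150, 30, 49, 157, 128, 183, 158, 23, 103, 164, 83, 233, 166, 51, 134, 170, 43, 112,
      172, 101, 191, 173, 148, 217, 174, 121, 263, 175, 136, 227, 176, 58, 196, 177, 28, 126, 178,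
      87, 142, 179, 97, 243, 180, 137, 147, 181, 45, 160, 182, 18, 230, 188, 4, 151, 189, 119,
      266, 190, 64, 152, 195, 37, 56, 197, 31, 34, 200, 22, 41, 201, 73, 129, 203, 93, 99, 204,
      59, 162, 205, 89, 143, 206, 120, 123, 207, 3, 65, 208, 21, 60, 209, 88, 168, 211, 16, 19,
      213, 5, 139, 214, 57, 130, 215, 117, 238, 216, 138, 167, 218, 81, 161, 219, 67, 96, 221,
      186, 199, 222, 42, 116, 223, 13, 169, 225, 79, 91, 226, 75, 132, 228, 12, 165, 229, 46, 118,
      231, 61, 155, 232, 20, 102, 234, 14, 84, 235, 110, 122, 236, 71, 114, 237, 82, 187, 239,
      146, 192, 240, 111, 131, 241, 47, 154, 242, 27, 95, 244, 70, 159, 245, 36, 149, 246, 113,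
      141, 247, 62, 135, 248, 2, 9, 249, 6, 76, 250, 10, 171, 251, 29, 98, 252, 26, 54, 253, 40,
      115, 254, 77, 92, 255, 1, 210, 256, 11, 68, 257, 66, 86, 258, 33, 55, 259, 0, 25, 260, 153,
      194, 261, 72, 100, 262, 94, 108, 265, 90, 133])]"

text \<open>
  Each entry consists of \<open>m\<close>, the bound \<open>u\<close> and the triples. The empty frame with \<open>u = 3\<close> stands for leaving a board
  unchanged; its bound expresses that the gap must be at least 4.
\<close>
definition frames :: "(int \<times> int \<times> int list) list" where
  "frames = [
    (0, 3, []),
    (6, 16, [0, 12, 14, 2, 6, 13, 3, 8, 10, 5, 11, 15, 16, 1, 7, 17, 4, 9]),
    (7, 18, [0, 11, 16, 2, 10, 17, 3, 12, 20, 8, 1, 13, 15, 5, 9, 18, 4, 14, 19, 6, 7]),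
    (8, 20, [0, 6, 9, 1, 11, 19, 2, 15, 17, 4, 12, 18, 8, 13, 20, 10, 14, 21, 22, 3, 5, 23, 7, 16]),
    (9, 22, [0, 15, 19, 1, 7, 17, 2, 9, 23, 4, 12, 13, 6, 18, 20, 21, 10, 16, 24, 11, 14, 25, 3, 5, 26,
      8, 22]),
    (10, 24, [1, 11, 18, 3, 21, 23, 6, 0, 14, 7, 16, 29, 8, 19, 24, 17, 5, 13, 25, 4, 10, 26, 2, 12, 27,
      20, 22, 28, 9, 15]),
    (11, 26, [0, 22, 24, 1, 16, 27, 6, 2, 25, 10, 3, 20, 15, 4, 23, 19, 13, 28, 21, 5, 8, 29, 11, 17, 30,
      7, 9, 31, 14, 26, 32, 12, 18]),
    (12, 28, [1, 11, 22, 2, 28, 30, 3, 12, 26, 6, 10, 21, 8, 16, 25, 14, 0, 33, 24, 17, 18, 29, 5, 7, 31,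
      4, 13, 32, 20, 27, 34, 9, 23, 35, 15, 19]),
    (13, 30, [1, 9, 24, 2, 21, 30, 3, 10, 32, 8, 20, 35, 11, 16, 28, 12, 6, 22, 14, 23, 27, 15, 31, 33,
      19, 5, 34, 25, 29, 36, 26, 0, 4, 37, 7, 13, 38, 17, 18]),
    (14, 32, [0, 16, 32, 2, 6, 20, 3, 10, 22, 9, 33, 37, 14, 23, 25, 19, 5, 31, 27, 1, 4, 30, 8, 24, 34,
      13, 17, 36, 21, 28, 38, 7, 18, 39, 26, 29, 40, 15, 35, 41, 11, 12]),
    (15, 34, [2, 25, 35, 4, 14, 34, 7, 33, 41, 11, 3, 43, 16, 10, 30, 23, 12, 42, 26, 21, 38, 27, 6, 9,
      28, 1, 15, 29, 5, 13, 31, 0, 22, 32, 17, 39, 37, 8, 20, 40, 18, 36, 44, 19, 24]),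
    (16, 36, [0, 32, 34, 4, 11, 22, 5, 25, 38, 10, 15, 41, 13, 28, 43, 14, 3, 26, 17, 27, 46, 19, 40, 42,
      20, 16, 33, 21, 29, 47, 23, 1, 39, 24, 7, 30, 31, 6, 45, 36, 9, 12, 37, 2, 18, 44, 8, 35]),
    (17, 38, [3, 24, 31, 7, 2, 44, 9, 22, 47, 11, 21, 38, 20, 6, 37, 27, 35, 42, 30, 0, 10, 32, 13, 28,
      34, 5, 25, 36, 1, 18, 39, 14, 16, 40, 4, 8, 41, 29, 48, 45, 19, 23, 46, 12, 15, 49, 33, 43,
      50, 17, 26])]"

text \<open>The size 12 and the odd multiples of three below \<open>6 \<cdot> 8 + 9\<close>, where the ring of nine lines begins to work.\<close>
definition half_boards :: "(int \<times> cell list) list" where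
  "half_boards = [
    (12, [(1,3), (1,9), (2,5), (2,7), (3,2), (4,11), (5,1), (6,12)]),
    (15, [(1,8), (2,5), (2,10), (3,14), (4,14), (5,1), (6,4), (6,7), (7,1), (8,3)]),
    (21, [(1,6), (1,18), (2,13), (2,14), (3,17), (4,7), (4,10), (5,3), (6,21), (7,3), (8,1), (9,17),
      (10,11), (11,2)]),
    (27, [(1,5), (1,9), (2,11), (2,15), (3,27), (4,25), (5,10), (5,20), (6,3), (7,14), (8,6), (9,27),
      (10,24), (11,12), (11,21), (12,6), (13,24), (14,2)]),
    (33, [(1,9), (1,23), (2,5), (3,19), (3,22), (4,5), (5,14), (5,18), (6,26), (7,32), (8,4), (8,6),
      (9,32), (10,27), (11,17), (12,1), (13,8), (14,21), (14,24), (15,27), (16,1), (17,3)]),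
    (39, [(1,20), (2,9), (2,13), (3,19), (3,25), (4,5), (4,22), (5,32), (6,29), (6,30), (7,1), (8,16),
      (8,23), (9,38), (10,6), (11,39), (12,7), (12,26), (13,4), (14,34), (15,12), (16,4), (17,38),
      (18,28), (19,32), (20,3)]),
    (45, [(1,18), (1,27), (2,41), (3,24), (3,36), (4,13), (5,20), (5,37), (6,2), (7,38), (8,7),
      (8,16), (9,29), (9,32), (10,13), (11,23), (12,25), (13,8), (14,42), (15,1), (16,6), (16,43),
      (17,15), (17,35), (18,2), (19,25), (20,42), (21,45), (22,41), (23,12)]),
    (51, [(1,31), (2,27), (3,15), (3,16), (4,26), (5,21), (6,34), (7,30), (7,38), (8,9), (8,40),
      (9,6), (9,33), (10,44), (11,3), (12,8), (13,42), (14,47), (15,1), (16,23), (16,35), (17,27),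
      (18,13), (18,45), (19,2), (19,28), (20,18), (21,1), (22,11), (22,48), (23,5), (24,3),
      (25,10), (26,20)])]"

definition base_sizes :: "(int \<times> int) list" where
  "base_sizes = map (\<lambda>(m, g, zs). (m, g)) bases"

definition frame_sizes :: "(int \<times> int) list" where
  "frame_sizes = map (\<lambda>(m, u, zs). (m, u)) frames"

lemma bases_ok: "list_all gapped_triples bases"
  by code_simp

lemma base_sizes_pos: "list_all (\<lambda>(m, g). 0 < m \<and> 1 \<le> g) base_sizes"
  by code_simp

lemma frames_ok: "list_all (\<lambda>(m, u, zs). frame_triples (m, 4, u, zs) \<and> 3 \<le> u) frames"
  by code_simp

lemma half_boards_ok: "list_all half_board_ok half_boards"
  by code_simp

lemma reached_initial: "list_all (reached base_sizes frame_sizes) [8..141]"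
  by code_simp

text \<open>
  The bases with \<open>d\<close> dividing 8 that contribute are 4 and 8. For them, 142 begins a full period
  of 48 consecutive numbers that are reached.
\<close>
lemma reached_period: "list_all (reached (filter (\<lambda>(m, g). m dvd 8) base_sizes) frame_sizes) [142..189]"
  by code_simp

lemma reached_directly:
  "list_all (\<lambda>k. k = 3 \<or> map_of half_boards (3 * k) \<noteq> None \<or>
     k mod 2 = 0 \<and> map_of base_sizes (k div 2) \<noteq> None) [2..18]"
  by code_simp

lemma gapped_of_base_size:
  assumes "(m, g) \<in> set base_sizes"
  shows "gapped m g \<and> 0 < m \<and> 1 \<le> g"
proof -
  obtain zs where "(m, g, zs) \<in> set bases" using assms by (auto simp: base_sizes_def)
  then have "gapped_triples (m, g, zs)" using bases_ok by (auto simp: list_all_iff)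
  then show ?thesis using gapped_of_triples assms base_sizes_pos by (auto simp: list_all_iff)
qed

lemma frame_of_frame_size:
  assumes "(m, u) \<in> set frame_sizes"
  shows "3 \<le> u \<and> (\<exists>zs. frame_triples (m, 4, u, zs))"
  using assms frames_ok by (auto simp: frame_sizes_def list_all_iff)

text \<open>
  Below 142 all bases are used. From there on the numbers reached by the bases 4 and 8 are invariant under
  adding 48.
\<close>
lemma gapped_four:
  assumes "8 \<le> m"
  shows "gapped m 4"
proof (cases "m \<le> 141")
  case True
  then have "m \<in> set [8..141]" using assms by (simp only: set_upto atLeastAtMost_iff)
  then have "reached base_sizes frame_sizes m"
    using reached_initial unfolding list_all_iff by blast
  from gapped_of_reached[OF this gapped_of_base_size frame_of_frame_size, of 0] show ?thesis by simp
next
  case False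
  let ?B = "filter (\<lambda>(m, g). m dvd 8) base_sizes"
  \<comment> \<open>\<open>n\<close> is the representative of \<open>m\<close> modulo 48 in the period that starts at 142.\<close>
  define t where "t = (m - 142) div 48"
  define n where "n = 142 + (m - 142) mod 48"
  have m: "m = n + 48 * t" by (simp add: t_def n_def)
  have "142 \<le> n" "n \<le> 189" unfolding n_def by (simp, presburger)
  then have "n \<in> set [142..189]" by (simp only: set_upto atLeastAtMost_iff)
  then have "reached ?B frame_sizes n" using reached_period unfolding list_all_iff by blast
  moreover have "gapped d g \<and> 0 < d \<and> 1 \<le> g" if "(d, g) \<in> set ?B" for d g
    using that gapped_of_base_size[of d g] by auto
  moreover have "0 \<le> t" using False by (simp add: t_def)
  moreover have "\<forall>(d, g)\<in>set ?B. d dvd 8" by auto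
  ultimately show ?thesis
    unfolding m using gapped_of_reached[of ?B frame_sizes n t] frame_of_frame_size by blast
qed

lemma fillable_multiple_of_3:
  assumes "2 \<le> k" "k \<noteq> 3"
  shows "fillable (3 * k)"
proof (cases "k \<le> 18")
  case True
  then have "k \<in> set [2..18]" using assms(1) by (simp only: set_upto atLeastAtMost_iff)
  then have "map_of half_boards (3 * k) \<noteq> None \<or> k mod 2 = 0 \<and> map_of base_sizes (k div 2) \<noteq> None"
    using reached_directly assms(2) unfolding list_all_iff by blast
  then show ?thesis
  proof
    assume "map_of half_boards (3 * k) \<noteq> None"
    then obtain H where "(3 * k, H) \<in> set half_boards" by (meson map_of_SomeD not_None_eq)
    then show ?thesis using half_boards_ok fillable_of_half by (auto simp: list_all_iff)
  next
    assume h: "k mod 2 = 0 \<and> map_of base_sizes (k div 2) \<noteq> None"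
    then obtain g where "(k div 2, g) \<in> set base_sizes" by (meson map_of_SomeD not_None_eq)
    then have "fillable (6 * (k div 2))" using gapped_of_base_size fillable_of_gapped by blast
    moreover have "k mod 2 = 0" using h by blast
    then have "6 * (k div 2) = 3 * k" by presburger
    ultimately show ?thesis by simp
  qed
next
  case False
  show ?thesis
  proof (cases "even k")
    case True
    then have k: "3 * k = 6 * (k div 2)" "8 \<le> k div 2" using \<open>\<not> k \<le> 18\<close> by presburger+
    have "fillable (6 * (k div 2))" using gapped_four[OF k(2)] fillable_of_gapped by force
    then show ?thesis unfolding k(1) .
  next
    case False
    then have k: "3 * k = 6 * ((k - 3) div 2) + 9" "8 \<le> (k - 3) div 2" using \<open>\<not> k \<le> 18\<close> by presburger+
    then show ?thesis using fillable_ring9[OF gapped_four[OF k(2)] k(2)] by metis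
  qed
qed

section \<open>Sizes at most five, and nine to eleven\<close>

fun aligned :: "cell \<Rightarrow> cell \<Rightarrow> bool" where
  "aligned (a, b) (c, d) \<longleftrightarrow> a = c \<or> b = d \<or> a - b = c - d \<or> a + b = c + d"

lemma on_common_line_aligned: "on_common_line p q \<longleftrightarrow> p \<noteq> q \<and> aligned p q"
  by (cases p; cases q) (auto simp: on_common_line_iff)

text \<open>
  A queen \<open>c\<close> may join \<open>acc\<close> if it has at most one companion \<open>q\<close> there, and \<open>q\<close> has none yet.
\<close>
fun joinable :: "cell list \<Rightarrow> cell \<Rightarrow> bool" where
  "joinable acc c = (case filter (aligned c) acc of [] \<Rightarrow> True
     | [q] \<Rightarrow> list_all (\<lambda>s. s = q \<or> \<not> aligned q s) acc | _ \<Rightarrow> False)"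

text \<open>
  Exhaustive search: can \<open>acc\<close> be extended by \<open>k\<close> cells of \<open>cs\<close>? Cells that have become
  impossible are dropped at once, and a branch ends when too few cells remain.
\<close>
fun extendable :: "nat \<Rightarrow> cell list \<Rightarrow> cell list \<Rightarrow> bool" where
  "extendable 0 acc cs = True"
| "extendable (Suc k) acc [] = False"
| "extendable (Suc k) acc (c # cs) \<longleftrightarrow>
     (k \<le> length cs) \<and> (extendable k (c # acc) (filter (joinable (c # acc)) cs) \<or> extendable (Suc k) acc cs)"

lemma joinableI:
  assumes "paired_at_most S" "set acc \<subseteq> S" "d \<in> S" "d \<notin> set acc" "distinct acc"
  shows "joinable acc d"
proof -
  have one: "x = y" if "x \<in> set (filter (aligned d) acc)" "y \<in> set (filter (aligned d) acc)" for x y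
  proof -
    have "x \<in> S" "y \<in> S" "on_common_line d x" "on_common_line d y"
      using that assms(2,4) by (auto simp: on_common_line_aligned)
    then show ?thesis using assms(1,3) unfolding paired_at_most_def by blast
  qed
  have dist: "distinct (filter (aligned d) acc)" using assms(5) by simp
  consider "filter (aligned d) acc = []" | q where "filter (aligned d) acc = [q]"
    | x y zs where "filter (aligned d) acc = x # y # zs"
    by (metis neq_Nil_conv)
  then show ?thesis
  proof cases
    case 1 then show ?thesis by simp
  next
    case (2 q)
    then have q: "q \<in> set acc" "aligned d q" by (auto simp: filter_eq_Cons_iff)
    have "s = q \<or> \<not> aligned q s" if s: "s \<in> set acc" for s
    proof (rule ccontr)
      assume "\<not> (s = q \<or> \<not> aligned q s)"
      then have "on_common_line q s" by (auto simp: on_common_line_aligned)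
      moreover have "on_common_line q d"
        using q assms(4) on_common_line_sym[of q d] by (auto simp: on_common_line_aligned)
      ultimately have "s = d" using assms(1-3) q(1) s unfolding paired_at_most_def by blast
      then show False using s assms(4) by blast
    qed
    then show ?thesis using 2 by (simp add: list_all_iff)
  next
    case (3 x y zs)
    then show ?thesis using one[of x y] dist by simp
  qed
qed

text \<open>The search misses no configuration, because a queen chosen later fits to those chosen before it.\<close>
lemma extendable_complete:
  assumes "paired_at_most (set acc \<union> A)" "A \<subseteq> set cs" "card A = k"
    "set acc \<inter> set cs = {}" "distinct acc" "distinct cs"
  shows "extendable k acc cs"
  using assms
proof (induction k acc cs arbitrary: A rule: extendable.induct)
  case (3 k acc c cs)
  have "card A \<le> card (set (c # cs))" using 3(4) by (intro card_mono) simp_all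
  also have "\<dots> \<le> length (c # cs)" by (rule card_length)
  finally have len: "k \<le> length cs" using 3(5) by simp
  have fin: "finite A" using 3(4) finite_subset by blast
  show ?case
  proof (cases "c \<in> A")
    case True
    let ?A = "A - {c}"
    have eq: "set (c # acc) \<union> ?A = set acc \<union> A" using True by auto
    have "joinable (c # acc) d" if "d \<in> ?A" for d
    proof (rule joinableI[OF 3(3)])
      show "set (c # acc) \<subseteq> set acc \<union> A" using True by auto
      show "d \<in> set acc \<union> A" "d \<notin> set (c # acc)" "distinct (c # acc)" using that 3(4,6,7) by auto
    qed
    then have "?A \<subseteq> set (filter (joinable (c # acc)) cs)" using 3(4) by (auto simp del: joinable.simps)
    moreover have "card ?A = k" using True 3(5) fin by simp
    ultimately have "extendable k (c # acc) (filter (joinable (c # acc)) cs)"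
      using 3(1)[of ?A] 3(3,6-8) eq by auto
    then show ?thesis using len by simp
  next
    case False
    then have "A \<subseteq> set cs" using 3(4) by auto
    then have "extendable (Suc k) acc cs" using 3(2)[of A] 3(3,5-8) by auto
    then show ?thesis using len by simp
  qed
qed auto

definition grid :: "int \<Rightarrow> cell list" where "grid n = List.product [1..n] [1..n]"

lemma queens_le_size:
  assumes "\<not> extendable (Suc n) [] (grid (int n))" "admissible n Q"
  shows "card Q \<le> n"
proof (rule ccontr)
  assume "\<not> card Q \<le> n"
  then obtain A where A: "A \<subseteq> Q" "card A = Suc n" using obtain_subset_with_card_n[of "Suc n" Q] by force
  have "Q \<subseteq> board n" "paired_at_most Q" using assms(2) by (auto simp: admissible_iff)
  then have "A \<subseteq> set (grid (int n))" "paired_at_most A"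
    using A(1) by (force simp: grid_def board_def, unfold paired_at_most_def, blast)
  then have "extendable (Suc n) [] (grid (int n))"
    using extendable_complete[of "[]" A "grid (int n)" "Suc n"] A(2) by (simp add: grid_def distinct_product)
  then show False using assms(1) by blast
qed

text \<open>
  The sizes to which the construction does not apply. With 9 rows the main diagonal cannot be kept free, so
  that sizes 10 and 11 need their own boards as well.
\<close>
definition small_board :: "nat \<Rightarrow> cell list" where
  "small_board n =
    (if n = 1 then [(1,1)]
     else if n = 2 then [(1,2), (2,2)]
     else if n = 3 then [(1,1), (1,3), (3,2)]
     else if n = 4 then [(1,1), (1,2), (2,4), (4,3)]
     else if n = 5 then [(1,1), (1,5), (3,2), (3,4), (5,3)]
     else if n = 9 then [(1,6), (2,3), (3,3), (4,6), (5,9), (6,9), (7,1), (7,2), (8,4), (8,5), (9,7), (9,8)]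
     else if n = 10 then [(1,4), (1,8), (2,1), (3,5), (3,9), (4,2), (5,10), (6,1), (7,7), (8,2), (9,10),
       (10,3), (10,6)]
     else [(1,10), (2,4), (2,6), (3,2), (4,10), (6,11), (7,2), (8,5), (8,8), (9,1), (9,3), (10,11),
       (11,7), (11,9)])"

lemma small_board_admissible:
  assumes "n \<in> {1, 2, 3, 4, 5, 9, 10, 11}"
  shows "\<exists>Q. admissible n Q \<and> card Q = length (small_board n)"
  using assms
  by (intro admissible_of_list) (elim insertE emptyE; simp add: small_board_def rook_paired_list_def)+

lemma no_extra_queen:
  "\<not> extendable (Suc 3) [] (grid 3)" "\<not> extendable (Suc 4) [] (grid 4)" "\<not> extendable (Suc 5) [] (grid 5)"
  by code_simp+

section \<open>The maximum\<close>

lemma max_queens_eq: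
  assumes "\<exists>Q. admissible n Q \<and> card Q = k" "\<And>Q. admissible n Q \<Longrightarrow> card Q \<le> k"
  shows "max_queens n = k"
proof -
  have "finite {card Q | Q. admissible n Q}"
    by (rule finite_subset[of _ "{..k}"]) (use assms(2) in auto)
  then show ?thesis unfolding max_queens_def
    by (intro Max_eqI) (use assms in auto)
qed
lemma max_queens_small:
  assumes "1 \<le> n" "n \<le> 5"
  shows "max_queens n = n"
proof (rule max_queens_eq)
  have n: "n \<in> {1, 2, 3, 4, 5}" using assms by auto
  then have "length (small_board n) = n" by (auto simp: small_board_def)
  then show "\<exists>Q. admissible n Q \<and> card Q = n" using small_board_admissible[of n] n by auto
  show "card Q \<le> n" if Q: "admissible n Q" for Q
  proof (cases "n \<le> 2")
    case True
    then show ?thesis using queens_le_four_thirds[OF Q] by linarith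
  next
    case False
    then have "n = 3 \<or> n = 4 \<or> n = 5" using n by auto
    then show ?thesis using queens_le_size[OF _ Q] no_extra_queen by auto
  qed
qed

lemma max_queens_large:
  assumes "6 \<le> n"
  shows "max_queens n = 4 * n div 3"
proof (rule max_queens_eq)
  show "card Q \<le> 4 * n div 3" if "admissible n Q" for Q
    using queens_le_four_thirds[OF that] by linarith
  show "\<exists>Q. admissible n Q \<and> card Q = 4 * n div 3"
  proof (cases "n div 3 = 3")
    case True
    then have n: "n = 9 \<or> n = 10 \<or> n = 11" by linarith
    then have "length (small_board n) = 4 * n div 3" by (auto simp: small_board_def)
    then show ?thesis using small_board_admissible[of n] n by auto
  next
    case False
    have "fillable (3 * int (n div 3))"
      using False assms by (intro fillable_multiple_of_3) simp_all
    moreover have "int n = 3 * int (n div 3) + int (n mod 3)" "n mod 3 \<le> 2" by presburger+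
    ultimately obtain Q where Q: "admissible n Q" "int (card Q) = 4 * int (n div 3) + int (n mod 3)"
      using fillable_sizes[of "int (n div 3)" "n mod 3" n] by auto
    have "card Q = 4 * (n div 3) + n mod 3" using Q(2) by linarith
    also have "\<dots> = 4 * n div 3" by presburger
    finally have "card Q = 4 * n div 3" .
    then show ?thesis using Q(1) by blast
  qed
qed

theorem theorem2p2:
  fixes n :: nat
  assumes "n \<ge> 1"
  shows "int (max_queens n) = (if n \<le> 5 then int n else \<lfloor>4 * real n / 3\<rfloor>)"
proof (cases "n \<le> 5")
  case True
  then show ?thesis using max_queens_small assms by simp
next
  case False
  have "\<lfloor>4 * real n / 3\<rfloor> = int (4 * n div 3)"
    using floor_divide_of_nat_eq[of "4 * n" 3] by simp
  then show ?thesis using False max_queens_large by simp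
qed

end
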